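(* Let $\mathbb{F}$ be a field, let $A\in\mathbb{F}^{n\times n}$, and let $f=\det(\operatorname{diag}(x_1,\dots,x_n)+A)\in\mathbb{F}[x_1,\dots,x_n]$. Let $[n]=T_1\sqcup\dots\sqcup T_s$ be a partition into nonempty sets and, for each $i$, let $f_i\in\mathbb{F}[x_k:k\in T_i]$ be a polynomial in which the coefficient of $\prod_{k\in T_i}x_k$ is $1$. Then $f=f_1\cdots f_s$ with each $f_i$ irreducible if and only if $A$ can be written, after permuting some rows and the corresponding columns, as a block upper triangular matrix with $s$ diagonal blocks which are, in some order, $A_1,\dots,A_s$, where $A_i=A[T_i,T_i]$, such that each $A_i$ is irreducible and $f_i=\det(A_i+\operatorname{diag}(x_k:k\in T_i))$.
   Context: $[n]=\{1,\dots,n\}$; $A[T,T]$ is the principal submatrix of $A$ with rows and columns indexed by $T$. A matrix is reducible if, after permuting some rows and the corresponding columns by the same permutation, it is block upper triangular with at least two (square, nonempty) diagonal blocks; otherwise it is irreducible. *)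

theory Defs
  imports
    "Jordan_Normal_Form.DL_Submatrix"
    "Jordan_Normal_Form.Determinant"
    "HOL-Library.Poly_Mapping"
    "HOL-Computational_Algebra.Polynomial"
    "HOL-Computational_Algebra.Factorial_Ring"
begin

section \<open>Polynomials in the variables \<open>x\<^sub>0, x\<^sub>1, \<dots>\<close>\<close>

text \<open>Exponent vectors are finitely supported functions \<^typ>\<open>nat \<Rightarrow>\<^sub>0 nat\<close>; the ring \<open>F[x\<^sub>k : k \<in> V]\<close>
  is the subring \<open>polys_in V\<close> below.\<close>

type_synonym 'a mpolynomial = "(nat \<Rightarrow>\<^sub>0 nat) \<Rightarrow>\<^sub>0 'a"

definition mconst :: "'a::zero \<Rightarrow> 'a mpolynomial" where
  "mconst c = Poly_Mapping.single 0 c"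

definition mvar :: "nat \<Rightarrow> 'a::zero_neq_one mpolynomial" where
  "mvar k = Poly_Mapping.single (Poly_Mapping.single k 1) 1"

definition mcoeff :: "'a::zero mpolynomial \<Rightarrow> (nat \<Rightarrow>\<^sub>0 nat) \<Rightarrow> 'a" where
  "mcoeff p m = Poly_Mapping.lookup p m"

definition squarefree_monomial :: "nat set \<Rightarrow> (nat \<Rightarrow>\<^sub>0 nat)" where
  "squarefree_monomial T = (\<Sum>k\<in>T. Poly_Mapping.single k 1)"

definition polys_in :: "nat set \<Rightarrow> 'a::zero mpolynomial set" where
  "polys_in V = {p. \<forall>m\<in>Poly_Mapping.keys p. Poly_Mapping.keys m \<subseteq> V}"

text \<open>For a nonzero element of \<open>polys_in V\<close> over a field, being irreducible in the ring of all
  polynomials is the same as being irreducible in the ring \<open>polys_in V\<close>: all its divisors lie in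
  \<open>polys_in V\<close>. To see this, substitute \<open>t \<cdot> x\<^sub>k\<close> for \<open>x\<^sub>k\<close> when \<open>k \<notin> V\<close>, and
  compare degrees in \<open>t\<close>.\<close>

definition outside_degree :: "nat set \<Rightarrow> (nat \<Rightarrow>\<^sub>0 nat) \<Rightarrow> nat" where
  "outside_degree V m = (\<Sum>k\<in>Poly_Mapping.keys m - V. Poly_Mapping.lookup m k)"

definition scale_outside :: "nat set \<Rightarrow> 'a::comm_ring_1 mpolynomial \<Rightarrow> 'a mpolynomial poly" where
  "scale_outside V p = (\<Sum>m\<in>Poly_Mapping.keys p.
     Polynomial.monom (Poly_Mapping.single m (Poly_Mapping.lookup p m)) (outside_degree V m))"

lemma outside_degree_superset:
  assumes "finite K" "Poly_Mapping.keys m \<subseteq> K"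
  shows "outside_degree V m = (\<Sum>k\<in>K - V. Poly_Mapping.lookup m k)"
  unfolding outside_degree_def
  using assms by (intro sum.mono_neutral_left) (auto simp: in_keys_iff)

lemma outside_degree_add: "outside_degree V (m + m') = outside_degree V m + outside_degree V m'"
proof -
  let ?K = "Poly_Mapping.keys m \<union> Poly_Mapping.keys m'"
  have "Poly_Mapping.keys (m + m') \<subseteq> ?K" by (rule keys_add)
  then show ?thesis
    by (simp add: outside_degree_superset[of ?K] lookup_add sum.distrib)
qed

lemma outside_degree_eq_0_iff: "outside_degree V m = 0 \<longleftrightarrow> Poly_Mapping.keys m \<subseteq> V"
  by (auto simp: outside_degree_def in_keys_iff)

lemma scale_outside_superset:
  assumes "finite K" "Poly_Mapping.keys p \<subseteq> K"
  shows "scale_outside V p = (\<Sum>m\<in>K.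
     Polynomial.monom (Poly_Mapping.single m (Poly_Mapping.lookup p m)) (outside_degree V m))"
  unfolding scale_outside_def
  using assms by (intro sum.mono_neutral_left) (auto simp: in_keys_iff)

lemma scale_outside_0 [simp]: "scale_outside V 0 = 0"
  by (simp add: scale_outside_def)

lemma scale_outside_add: "scale_outside V (p + q) = scale_outside V p + scale_outside V q"
proof -
  let ?K = "Poly_Mapping.keys p \<union> Poly_Mapping.keys q"
  have "Poly_Mapping.keys (p + q) \<subseteq> ?K" by (rule keys_add)
  then show ?thesis
    by (simp add: scale_outside_superset[of ?K] lookup_add single_add add_monom[symmetric]
        sum.distrib)
qed

lemma scale_outside_sum: "scale_outside V (sum f S) = (\<Sum>i\<in>S. scale_outside V (f i))"
  by (induction S rule: infinite_finite_induct) (auto simp: scale_outside_add)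

lemma scale_outside_single:
  "scale_outside V (Poly_Mapping.single m c)
     = Polynomial.monom (Poly_Mapping.single m c) (outside_degree V m)"
  by (subst scale_outside_superset[of "{m}"]) auto

lemma sum_single_keys:
  "(\<Sum>m\<in>Poly_Mapping.keys p. Poly_Mapping.single m (Poly_Mapping.lookup p m)) = p"
  by (rule poly_mapping_eqI)
    (auto simp: lookup_sum lookup_single when_def in_keys_iff sum.delta)

lemma scale_outside_mult: "scale_outside V (p * q) = scale_outside V p * scale_outside V q"
proof -
  have "p * q = (\<Sum>m\<in>Poly_Mapping.keys p. \<Sum>m'\<in>Poly_Mapping.keys q.
      Poly_Mapping.single m (Poly_Mapping.lookup p m) *
      Poly_Mapping.single m' (Poly_Mapping.lookup q m'))"
    by (subst (1) sum_single_keys[of p, symmetric], subst (1) sum_single_keys[of q, symmetric])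
      (simp only: sum_product)
  then show ?thesis
    by (simp add: scale_outside_sum scale_outside_single mult_single outside_degree_add
        scale_outside_def[of V p] scale_outside_def[of V q] sum_product mult_monom)
qed

lemma coeff_scale_outside:
  "Poly_Mapping.lookup (Polynomial.coeff (scale_outside V p) d) m
     = (if outside_degree V m = d then Poly_Mapping.lookup p m else 0)"
proof -
  have "Poly_Mapping.lookup (Polynomial.coeff (scale_outside V p) d) m
      = (\<Sum>m'\<in>Poly_Mapping.keys p. if m' = m then
           (if outside_degree V m = d then Poly_Mapping.lookup p m else 0) else 0)"
    unfolding scale_outside_def coeff_sum lookup_sum
    by (rule sum.cong) (auto simp: lookup_single when_def)
  then show ?thesis by (auto simp: sum.delta in_keys_iff)
qed

lemma scale_outside_eq_0_iff: "scale_outside V p = 0 \<longleftrightarrow> p = 0"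
proof
  assume *: "scale_outside V p = 0"
  show "p = 0"
  proof (rule poly_mapping_eqI)
    fix m show "Poly_Mapping.lookup p m = Poly_Mapping.lookup 0 m"
      using coeff_scale_outside[of V p "outside_degree V m" m] * by simp
  qed
qed simp

lemma monom_sum_0: "(\<Sum>i\<in>S. Polynomial.monom (f i) 0) = Polynomial.monom (sum f S) 0"
  by (induction S rule: infinite_finite_induct) (auto simp: add_monom)

lemma degree_scale_outside_eq_0_iff:
  "Polynomial.degree (scale_outside V p) = 0 \<longleftrightarrow> p \<in> polys_in V"
proof
  assume *: "Polynomial.degree (scale_outside V p) = 0"
  show "p \<in> polys_in V"
  proof (unfold polys_in_def, clarify)
    fix m k assume m: "m \<in> Poly_Mapping.keys p" and k: "k \<in> Poly_Mapping.keys m"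
    have "outside_degree V m = 0"
    proof (rule ccontr)
      assume "outside_degree V m \<noteq> 0"
      then have "Polynomial.coeff (scale_outside V p) (outside_degree V m) = 0"
        using * by (intro coeff_eq_0) auto
      with coeff_scale_outside[of V p "outside_degree V m" m] m show False
        by (simp add: in_keys_iff)
    qed
    with k show "k \<in> V" by (auto simp: outside_degree_eq_0_iff)
  qed
next
  assume "p \<in> polys_in V"
  then have "\<forall>m\<in>Poly_Mapping.keys p. outside_degree V m = 0"
    by (auto simp: polys_in_def outside_degree_eq_0_iff)
  then have "scale_outside V p = (\<Sum>m\<in>Poly_Mapping.keys p.
      Polynomial.monom (Poly_Mapping.single m (Poly_Mapping.lookup p m)) 0)"
    by (simp add: scale_outside_def)
  also have "\<dots> = Polynomial.monom p 0"
    using monom_sum_0[of "\<lambda>m. Poly_Mapping.single m (Poly_Mapping.lookup p m)" "Poly_Mapping.keys p"]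
    by (simp add: sum_single_keys)
  finally show "Polynomial.degree (scale_outside V p) = 0"
    by (simp add: degree_monom_eq monom_0)
qed

lemma mult_in_polys_in_iff:
  fixes p q :: "'a::idom mpolynomial"
  assumes "p * q \<noteq> 0"
  shows "p * q \<in> polys_in V \<longleftrightarrow> p \<in> polys_in V \<and> q \<in> polys_in V"
proof -
  have "scale_outside V p \<noteq> 0" "scale_outside V q \<noteq> 0"
    using assms by (auto simp: scale_outside_eq_0_iff)
  then show ?thesis
    by (simp add: degree_scale_outside_eq_0_iff[symmetric] scale_outside_mult degree_mult_eq)
qed

lemma one_in_polys_in: "1 \<in> polys_in V"
  by (simp add: polys_in_def)

lemma irreducible_iff_irreducible_in_polys_in:
  fixes p :: "'a::idom mpolynomial"
  assumes p: "p \<in> polys_in V"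
  shows "irreducible p \<longleftrightarrow> p \<noteq> 0 \<and> \<not> (\<exists>u\<in>polys_in V. p * u = 1) \<and>
    (\<forall>a\<in>polys_in V. \<forall>b\<in>polys_in V. p = a * b \<longrightarrow>
       (\<exists>u\<in>polys_in V. a * u = 1) \<or> (\<exists>u\<in>polys_in V. b * u = 1))"
proof -
  have unit: "a dvd 1 \<longleftrightarrow> (\<exists>u\<in>polys_in V. a * u = 1)" for a :: "'a mpolynomial"
    using mult_in_polys_in_iff[of a _ V] one_in_polys_in[of V] by (metis dvd_def zero_neq_one)
  have factors: "a \<in> polys_in V \<and> b \<in> polys_in V" if "p = a * b" "p \<noteq> 0" for a b
    using mult_in_polys_in_iff[of a b V] p that by blast
  show ?thesis
    unfolding irreducible_def unit using factors by blast
qed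


section \<open>Block triangular and irreducible matrices\<close>

definition permute_mat :: "(nat \<Rightarrow> nat) \<Rightarrow> 'a mat \<Rightarrow> 'a mat" where
  "permute_mat \<sigma> A = mat (dim_row A) (dim_col A) (\<lambda>(i, j). A $$ (\<sigma> i, \<sigma> j))"

definition principal_submatrix :: "'a mat \<Rightarrow> nat set \<Rightarrow> 'a mat" where
  "principal_submatrix A T = submatrix A T T"

definition block_indices :: "nat list \<Rightarrow> nat \<Rightarrow> nat set" where
  "block_indices ds k = {sum_list (take k ds)..<sum_list (take (Suc k) ds)}"

text \<open>The list \<open>ds\<close> gives the sizes of the (nonempty, square) diagonal blocks.\<close>

definition block_upper_triangular :: "nat list \<Rightarrow> 'a::zero mat \<Rightarrow> bool" where
  "block_upper_triangular ds B \<longleftrightarrow>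
     B \<in> carrier_mat (sum_list ds) (sum_list ds) \<and> (\<forall>d\<in>set ds. 0 < d) \<and>
     (\<forall>k<length ds. \<forall>l<k. \<forall>i\<in>block_indices ds k. \<forall>j\<in>block_indices ds l. B $$ (i, j) = 0)"

definition reducible_mat :: "'a::zero mat \<Rightarrow> bool" where
  "reducible_mat A \<longleftrightarrow> (\<exists>\<sigma> ds. \<sigma> permutes {..<dim_row A} \<and> 2 \<le> length ds \<and>
     block_upper_triangular ds (permute_mat \<sigma> A))"

definition irreducible_mat :: "'a::zero mat \<Rightarrow> bool" where
  "irreducible_mat A \<longleftrightarrow> square_mat A \<and> \<not> reducible_mat A"

text \<open>\<open>det (diag (x\<^sub>k : k \<in> T) + B)\<close> for a \<open>|T| \<times> |T|\<close> matrix \<open>B\<close>, the variables being placed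
  on the diagonal in increasing order of their indices (\<open>pick T i\<close> is the \<open>i\<close>-th smallest element
  of \<open>T\<close>), as the rows of \<^const>\<open>principal_submatrix\<close> are.\<close>

definition det_diag_plus :: "nat set \<Rightarrow> 'a::comm_ring_1 mat \<Rightarrow> 'a mpolynomial" where
  "det_diag_plus T B = det (mat_diag (card T) (\<lambda>i. mvar (pick T i)) + map_mat mconst B)"

end

theory Submission
  imports Defs
begin

text \<open>
  Everything rests on the following fact: \<^emph>\<open>if \<open>f = g * h\<close> and the variables \<open>x\<^sub>i\<close> and \<open>x\<^sub>j\<close> occur in
  different factors, then in the digraph of \<open>A\<close> (an edge \<open>k \<rightarrow> l\<close> for each nonzero \<open>A $$ (k, l)\<close>) there are not
  both a path from \<open>i\<close> to \<open>j\<close> and a path from \<open>j\<close> to \<open>i\<close>.\<close>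

  To see this, let \<open>M = diag(x) + A\<close> and write \<open>C\<close> for its adjugate. Let \<open>f\<^sub>i\<close>, \<open>f\<^sub>j\<close>, \<open>f\<^sub>i\<^sub>j\<close> be \<open>f\<close> with
  \<open>x\<^sub>i = 0\<close>, with \<open>x\<^sub>j = 0\<close>, and with both. Jacobi's identity for \<open>2 \<times> 2\<close> minors of the adjugate,
  in a form without division, says that \<open>f\<^sub>i * f\<^sub>j - f * f\<^sub>i\<^sub>j = x\<^sub>i * x\<^sub>j * C\<^sub>i\<^sub>j * C\<^sub>j\<^sub>i\<close>
  (\<open>det_two_diag_entries\<close>). If \<open>x\<^sub>i\<close> occurs only in \<open>g\<close> and \<open>x\<^sub>j\<close> only in \<open>h\<close>, then both products on the
  left are \<open>g * g\<^sub>i * h * h\<^sub>j\<close>, so one of \<open>C\<^sub>i\<^sub>j\<close>, \<open>C\<^sub>j\<^sub>i\<close> vanishes. But a path from \<open>i\<close> to \<open>j\<close> makes \<open>C\<^sub>i\<^sub>j\<close>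
  nonzero (\<open>cofactor_var_mat_nonzero\<close>): an induced such path with vertex set \<open>P\<close> is the only source of the monomial
  \<open>\<Prod>k\<notin>P. x\<^sub>k\<close> in \<open>C\<^sub>i\<^sub>j\<close>.

  If \<open>A\<close> is irreducible, then its digraph is strongly connected, so all variables occur in one factor, and the other
  factor is a constant: \<open>f\<close> is irreducible (\<open>irreducible_det_var_mat\<close>). As the determinant of a block
  triangular matrix is the product over its diagonal blocks, this gives the direction from blocks to factors.

  Conversely, let \<open>f\<close> be the product of irreducible \<open>f\<^sub>1, \<dots>, f\<^sub>s\<close>. Every matrix can be brought into block triangular
  form with irreducible diagonal blocks \<open>A[X,X]\<close> (\<open>triangular_partition_irreducible_blocks\<close>). Any
  two indices in \<open>X\<close> are joined by paths both ways, so \<open>X\<close> lies in a single \<open>T\<^sub>i\<close>. The minors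
  \<open>det(diag(x\<^sub>k : k \<in> X) + A[X,X])\<close> with \<open>X \<subseteq> T\<^sub>i\<close> multiply to a polynomial \<open>F\<^sub>i\<close> in the variables of \<open>T\<^sub>i\<close>, and
  \<open>\<Prod>i. F\<^sub>i = f = \<Prod>i. f\<^sub>i\<close>. Factors in disjoint sets of variables are determined by their product once
  normalized (\<open>factors_unique\<close>), so \<open>f\<^sub>i = F\<^sub>i\<close>; this being irreducible, only one block \<open>X\<close> lies in \<open>T\<^sub>i\<close>, and
  \<open>X = T\<^sub>i\<close>.
\<close>


section \<open>Two diagonal entries of a matrix\<close>

definition add_diag_entry :: "nat \<Rightarrow> 'a \<Rightarrow> 'a::comm_ring_1 mat \<Rightarrow> 'a mat" where
  "add_diag_entry i a M = mat (dim_row M) (dim_col M)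
     (\<lambda>(k, l). M $$ (k, l) + (if k = i \<and> l = i then a else 0))"

lemma add_diag_entry_carrier [simp]:
  "M \<in> carrier_mat n n \<Longrightarrow> add_diag_entry i a M \<in> carrier_mat n n"
  by (simp add: add_diag_entry_def)

lemma add_diag_entry_index:
  assumes "M \<in> carrier_mat n n" "k < n" "l < n"
  shows "add_diag_entry i a M $$ (k, l) = M $$ (k, l) + (if k = i \<and> l = i then a else 0)"
  using assms by (auto simp: add_diag_entry_def)

lemma adj_mat_index:
  assumes "M \<in> carrier_mat n n" "i < n" "j < n"
  shows "adj_mat M $$ (i, j) = cofactor M j i"
  using assms by (auto simp: adj_mat_def)

lemma mult_mat_index_sum:
  assumes "A \<in> carrier_mat n n" "B \<in> carrier_mat n n" "i < n" "j < n"
  shows "(A * B) $$ (i, j) = (\<Sum>k<n. A $$ (i, k) * B $$ (k, j))"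
  using assms by (auto simp: scalar_prod_def atLeast0LessThan)

lemma cofactor_cong:
  assumes M: "M \<in> carrier_mat n n" and N: "N \<in> carrier_mat n n"
    and eq: "\<And>p q. p < n \<Longrightarrow> q < n \<Longrightarrow> p \<noteq> k \<Longrightarrow> q \<noteq> l \<Longrightarrow> M $$ (p, q) = N $$ (p, q)"
  shows "cofactor M k l = cofactor N k l"
proof -
  have "mat_delete M k l = mat_delete N k l"
    unfolding mat_delete_def using M N by (intro cong_mat) (auto intro!: eq)
  then show ?thesis by (simp add: cofactor_def)
qed

lemma cofactor_add_diag_entry:
  assumes "M \<in> carrier_mat n n" "k = i \<or> l = i"
  shows "cofactor (add_diag_entry i a M) k l = cofactor M k l"
  using assms by (intro cofactor_cong[of _ n]) (auto simp: add_diag_entry_index)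

lemma det_add_diag_entry:
  assumes M: "M \<in> carrier_mat n n" and i: "i < n"
  shows "det (add_diag_entry i a M) = det M + a * cofactor M i i"
proof -
  have "det (add_diag_entry i a M)
      = (\<Sum>j<n. add_diag_entry i a M $$ (i, j) * cofactor (add_diag_entry i a M) i j)"
    using M i by (intro laplace_expansion_row) auto
  also have "\<dots> = (\<Sum>j<n. M $$ (i, j) * cofactor M i j
      + (if j = i then a * cofactor M i i else 0))"
    using M i by (intro sum.cong)
      (auto simp: cofactor_add_diag_entry[OF M] add_diag_entry_index[OF M] algebra_simps)
  also have "\<dots> = det M + a * cofactor M i i"
    using i by (simp add: sum.distrib laplace_expansion_row[OF M i])
  finally show ?thesis .
qed

text \<open>How a diagonal cofactor reacts to a change of another diagonal entry. Evaluate \<open>adj M * M' * adj M'\<close> in two ways, where \<open>M'\<close> is \<open>M\<close> with \<open>a\<close> added at \<open>(i, i)\<close>: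
  \<open>M' * adj M' = det M'\<close>, and \<open>adj M * M'\<close> is \<open>det M\<close> plus a matrix supported in column \<open>i\<close>.\<close>

lemma cofactor_add_diag_entry_other:
  assumes M: "M \<in> carrier_mat n n" and i: "i < n" and j: "j < n"
  shows "det (add_diag_entry i a M) * cofactor M j j
     = det M * cofactor (add_diag_entry i a M) j j + a * cofactor M i j * cofactor M j i"
proof -
  let ?M' = "add_diag_entry i a M"
  let ?C = "adj_mat M" and ?C' = "adj_mat ?M'"
  define E where "E = mat n n (\<lambda>(k, l). if k = i \<and> l = i then a else 0)"
  have M': "?M' \<in> carrier_mat n n" and E: "E \<in> carrier_mat n n"
    using M by (auto simp: E_def)
  note C = adj_mat[OF M] and C' = adj_mat[OF M']
  have M'_eq: "?M' = M + E"
    using M by (intro eq_matI) (auto simp: add_diag_entry_def E_def)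
  have CE: "(?C * E) $$ (k, l) = (if l = i then a * cofactor M i k else 0)" if "k < n" "l < n" for k l
  proof -
    have "(?C * E) $$ (k, l) = (\<Sum>p<n. ?C $$ (k, p) * E $$ (p, l))"
      by (rule mult_mat_index_sum[OF C(1) E that])
    also have "\<dots> = (\<Sum>p<n. if p = i then (if l = i then a * cofactor M i k else 0) else 0)"
      using that M i by (intro sum.cong) (auto simp: E_def adj_mat_index)
    finally show ?thesis using i by simp
  qed
  have CEC: "?C * E \<in> carrier_mat n n" "(?C * E) * ?C' \<in> carrier_mat n n"
    using C(1) C'(1) E by auto
  have "?C * (?M' * ?C') = (?C * ?M') * ?C'"
    using C(1) C'(1) M' by (intro assoc_mult_mat[symmetric])
  also have "?C * ?M' = det M \<cdot>\<^sub>m 1\<^sub>m n + ?C * E"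
    unfolding M'_eq C(3)[symmetric] by (rule mult_add_distrib_mat[OF C(1) M E])
  also have "(det M \<cdot>\<^sub>m 1\<^sub>m n + ?C * E) * ?C' = (det M \<cdot>\<^sub>m 1\<^sub>m n) * ?C' + (?C * E) * ?C'"
    using CEC C'(1) by (intro add_mult_distrib_mat) auto
  also have "(det M \<cdot>\<^sub>m 1\<^sub>m n) * ?C' = det M \<cdot>\<^sub>m ?C'"
    using C'(1) by (subst mult_smult_assoc_mat) auto
  finally have eq: "?C * (det ?M' \<cdot>\<^sub>m 1\<^sub>m n) = det M \<cdot>\<^sub>m ?C' + (?C * E) * ?C'"
    by (simp only: C'(2))
  have "det ?M' * cofactor M j j = (?C * (det ?M' \<cdot>\<^sub>m 1\<^sub>m n)) $$ (j, j)"
    using C(1) M j by (subst mult_smult_distrib[of _ n n _ n]) (auto simp: adj_mat_index)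
  also have "\<dots> = det M * cofactor ?M' j j + ((?C * E) * ?C') $$ (j, j)"
    unfolding eq index_add_mat(1)[of j "(?C * E) * ?C'" j, unfolded carrier_matD[OF CEC(2)], OF j j]
    using C'(1) j M' by (simp add: adj_mat_index)
  also have "((?C * E) * ?C') $$ (j, j) = (\<Sum>k<n. (?C * E) $$ (j, k) * ?C' $$ (k, j))"
    by (rule mult_mat_index_sum[OF CEC(1) C'(1) j j])
  also have "\<dots> = (\<Sum>k<n. if k = i then a * cofactor M i j * cofactor M j i else 0)"
    using j by (intro sum.cong)
      (auto simp: CE adj_mat_index[OF M'] cofactor_add_diag_entry[OF M] simp del: index_mult_mat(1))
  finally show ?thesis using i by simp
qed

text \<open>Jacobi's identity for the \<open>2 \<times> 2\<close> minors of the adjugate, stated with finite differences in place of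
  derivatives along the diagonal, so that it needs no division. The term with the two cofactors measures how far the
  determinant is from being a product of a function of the \<open>i\<close>-th and a function of the \<open>j\<close>-th diagonal entry.\<close>

lemma det_two_diag_entries:
  assumes M: "M \<in> carrier_mat n n" and i: "i < n" and j: "j < n" and ij: "i \<noteq> j"
  shows "det (add_diag_entry i a M) * det (add_diag_entry j b M)
     = det M * det (add_diag_entry j b (add_diag_entry i a M))
       + a * b * cofactor M i j * cofactor M j i"
  using cofactor_add_diag_entry_other[OF M i j, of a]
  by (simp add: det_add_diag_entry[OF _ j] M algebra_simps)


section \<open>Polynomials and their variables\<close>

lemma mpolynomial_eqI: "(\<And>m. mcoeff p m = mcoeff q m) \<Longrightarrow> p = q"
  by (auto simp: mcoeff_def intro: poly_mapping_eqI)

lemma mcoeff_add: "mcoeff (p + q) m = mcoeff p m + mcoeff q m"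
  by (simp add: mcoeff_def lookup_add)

lemma mcoeff_sum: "mcoeff (sum f S) m = (\<Sum>i\<in>S. mcoeff (f i) m)"
  by (simp add: mcoeff_def lookup_sum)

lemma mcoeff_0 [simp]: "mcoeff 0 m = 0"
  by (simp add: mcoeff_def)

lemma in_polys_in_iff: "p \<in> polys_in V \<longleftrightarrow> (\<forall>m. mcoeff p m \<noteq> 0 \<longrightarrow> Poly_Mapping.keys m \<subseteq> V)"
  by (auto simp: polys_in_def mcoeff_def in_keys_iff)

lemma mcoeff_eq_0: "p \<in> polys_in (-{k}) \<Longrightarrow> Poly_Mapping.lookup m k \<noteq> 0 \<Longrightarrow> mcoeff p m = 0"
  unfolding in_polys_in_iff by (auto simp: in_keys_iff)

lemma polys_in_mono: "p \<in> polys_in V \<Longrightarrow> V \<subseteq> W \<Longrightarrow> p \<in> polys_in W"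
  by (auto simp: polys_in_def)

lemma zero_in_polys_in [simp]: "0 \<in> polys_in V"
  by (simp add: polys_in_def)

lemma add_in_polys_in: "p \<in> polys_in V \<Longrightarrow> q \<in> polys_in V \<Longrightarrow> p + q \<in> polys_in V"
  unfolding polys_in_def using keys_add[of p q] by blast

lemma mult_in_polys_in:
  fixes p q :: "'a::comm_ring_1 mpolynomial"
  assumes p: "p \<in> polys_in V" and q: "q \<in> polys_in V"
  shows "p * q \<in> polys_in V"
  unfolding polys_in_def
proof (clarify)
  fix m k assume m: "m \<in> Poly_Mapping.keys (p * q)" "k \<in> Poly_Mapping.keys m"
  then obtain a b where "m = a + b" "a \<in> Poly_Mapping.keys p" "b \<in> Poly_Mapping.keys q"
    using keys_mult[of p q] by blast
  with m(2) p q show "k \<in> V"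
    using keys_add[of a b] unfolding polys_in_def by blast
qed

lemma uminus_in_polys_in: "p \<in> polys_in V \<Longrightarrow> - p \<in> polys_in V"
  for p :: "'a::comm_ring_1 mpolynomial"
  by (auto simp: polys_in_def in_keys_iff)

lemma sum_in_polys_in: "(\<And>i. i \<in> S \<Longrightarrow> f i \<in> polys_in V) \<Longrightarrow> sum f S \<in> polys_in V"
  by (induction S rule: infinite_finite_induct) (auto intro: add_in_polys_in)

lemma prod_in_polys_in: "(\<And>i. i \<in> S \<Longrightarrow> f i \<in> polys_in V) \<Longrightarrow> prod f S \<in> polys_in V"
  for f :: "'b \<Rightarrow> 'a::comm_ring_1 mpolynomial"
  by (induction S rule: infinite_finite_induct) (auto intro: mult_in_polys_in one_in_polys_in)

lemma mconst_in_polys_in [simp]: "mconst c \<in> polys_in V"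
  by (auto simp: polys_in_def mconst_def split: if_splits)

lemma mvar_in_polys_in: "mvar k \<in> polys_in V \<longleftrightarrow> k \<in> V" for V :: "nat set"
  by (auto simp: polys_in_def mvar_def)

lemma det_in_polys_in:
  assumes M: "M \<in> carrier_mat n n"
    and "\<And>i j. i < n \<Longrightarrow> j < n \<Longrightarrow> M $$ (i, j) \<in> polys_in V"
  shows "det M \<in> polys_in V"
proof -
  have sgn: "signof p * prod f S \<in> polys_in V" if "prod f S \<in> polys_in V"
    for p S and f :: "nat \<Rightarrow> 'a mpolynomial"
    using that by (auto simp: sign_def intro: uminus_in_polys_in)
  show ?thesis
    unfolding det_def'[OF M]
  proof (intro sum_in_polys_in)
    fix p assume "p \<in> {p. p permutes {0..<n}}"
    then have "(\<Prod>i = 0..<n. M $$ (i, p i)) \<in> polys_in V"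
      by (intro prod_in_polys_in assms) (auto dest: permutes_in_image)
    then show "signof p * (\<Prod>i = 0..<n. M $$ (i, p i)) \<in> polys_in V"
      by (rule sgn)
  qed
qed

lemma polys_in_empty_unit:
  fixes p :: "'a::field mpolynomial"
  assumes "p \<in> polys_in {}" "p \<noteq> 0"
  shows "p dvd 1"
proof -
  have "p = Poly_Mapping.single 0 (mcoeff p 0)"
  proof (rule mpolynomial_eqI)
    fix m show "mcoeff p m = mcoeff (Poly_Mapping.single 0 (mcoeff p 0)) m"
      using assms(1) unfolding in_polys_in_iff
      by (cases "m = 0") (auto simp: mcoeff_def lookup_single when_def)
  qed
  moreover from this assms(2) have nz: "mcoeff p 0 \<noteq> 0" by (metis single_zero)
  moreover have "Poly_Mapping.single 0 (mcoeff p 0) * Poly_Mapping.single 0 (1 / mcoeff p 0)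
      = (1 :: 'a mpolynomial)"
    using nz by (simp add: mult_single)
  ultimately show ?thesis by (metis dvdI)
qed

subsection \<open>Coefficients of products\<close>

lemma mcoeff_mult:
  fixes p q :: "'a::comm_ring_1 mpolynomial"
  shows "mcoeff (p * q) m = (\<Sum>a\<in>Poly_Mapping.keys p. \<Sum>b\<in>Poly_Mapping.keys q.
    if a + b = m then mcoeff p a * mcoeff q b else 0)"
proof -
  have "p * q = (\<Sum>a\<in>Poly_Mapping.keys p. \<Sum>b\<in>Poly_Mapping.keys q.
      Poly_Mapping.single (a + b) (mcoeff p a * mcoeff q b))"
    by (subst (1) sum_single_keys[of p, symmetric], subst (1) sum_single_keys[of q, symmetric])
      (simp add: sum_product mult_single mcoeff_def)
  then have "mcoeff (p * q) m = (\<Sum>a\<in>Poly_Mapping.keys p. \<Sum>b\<in>Poly_Mapping.keys q.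
      mcoeff (Poly_Mapping.single (a + b) (mcoeff p a * mcoeff q b)) m)"
    by (simp only: mcoeff_sum)
  then show ?thesis
    by (simp add: mcoeff_def lookup_single when_def cong: if_cong)
qed

text \<open>Each monomial in the variables \<open>V \<union> W\<close> splits in only one way into a monomial in \<open>V\<close> and one in \<open>W\<close>, so the
  convolution sum has a single term.\<close>

lemma mcoeff_mult_disjoint:
  fixes p q :: "'a::comm_ring_1 mpolynomial"
  assumes p: "p \<in> polys_in V" and q: "q \<in> polys_in W" and VW: "V \<inter> W = {}"
    and a: "Poly_Mapping.keys a \<subseteq> V" and b: "Poly_Mapping.keys b \<subseteq> W"
  shows "mcoeff (p * q) (a + b) = mcoeff p a * mcoeff q b"
proof -
  have eq_iff: "a' + b' = a + b \<longleftrightarrow> a' = a \<and> b' = b"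
    if "a' \<in> Poly_Mapping.keys p" "b' \<in> Poly_Mapping.keys q" for a' b'
  proof
    assume *: "a' + b' = a + b"
    have supp: "Poly_Mapping.keys a' \<subseteq> V" "Poly_Mapping.keys b' \<subseteq> W"
      using that p q by (auto simp: polys_in_def)
    have **: "Poly_Mapping.lookup a' k + Poly_Mapping.lookup b' k
        = Poly_Mapping.lookup a k + Poly_Mapping.lookup b k" for k
      using * by (metis lookup_add)
    have zero: "Poly_Mapping.lookup a' k = 0 \<and> Poly_Mapping.lookup a k = 0
        \<or> Poly_Mapping.lookup b' k = 0 \<and> Poly_Mapping.lookup b k = 0" for k
      using supp a b VW by (auto simp: in_keys_iff[symmetric] not_in_keys_iff_lookup_eq_zero[symmetric])
    have "Poly_Mapping.lookup a' k = Poly_Mapping.lookup a k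
        \<and> Poly_Mapping.lookup b' k = Poly_Mapping.lookup b k" for k
      using **[of k] zero[of k] by auto
    then show "a' = a \<and> b' = b" by (auto intro: poly_mapping_eqI)
  qed simp
  have "mcoeff (p * q) (a + b) = (\<Sum>a'\<in>Poly_Mapping.keys p. \<Sum>b'\<in>Poly_Mapping.keys q.
      if a' = a then if b' = b then mcoeff p a * mcoeff q b else 0 else 0)"
    unfolding mcoeff_mult by (intro sum.cong) (auto simp: eq_iff)
  also have "\<dots> = (\<Sum>a'\<in>Poly_Mapping.keys p. if a' = a then mcoeff p a * mcoeff q b else 0)"
    by (intro sum.cong) (auto simp: sum.delta mcoeff_def in_keys_iff)
  also have "\<dots> = mcoeff p a * mcoeff q b"
    by (auto simp: sum.delta mcoeff_def in_keys_iff)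
  finally show ?thesis .
qed

lemma mcoeff_prod_disjoint:
  fixes p :: "'i \<Rightarrow> 'a::comm_ring_1 mpolynomial"
  assumes "finite I" "\<And>i. i \<in> I \<Longrightarrow> p i \<in> polys_in (V i)" "disjoint_family_on V I"
    and "\<And>i. i \<in> I \<Longrightarrow> Poly_Mapping.keys (a i) \<subseteq> V i"
  shows "mcoeff (\<Prod>i\<in>I. p i) (\<Sum>i\<in>I. a i) = (\<Prod>i\<in>I. mcoeff (p i) (a i))"
  using assms
proof (induction I rule: finite_induct)
  case empty
  then show ?case by (simp add: mcoeff_def lookup_one)
next
  case (insert i I)
  have "mcoeff (p i * (\<Prod>i\<in>I. p i)) (a i + (\<Sum>i\<in>I. a i)) = mcoeff (p i) (a i) * mcoeff (\<Prod>i\<in>I. p i) (\<Sum>i\<in>I. a i)"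
  proof (rule mcoeff_mult_disjoint)
    show "(\<Prod>i\<in>I. p i) \<in> polys_in (\<Union>i\<in>I. V i)"
      using insert.prems(1) by (intro prod_in_polys_in) (auto intro: polys_in_mono)
    show "V i \<inter> (\<Union>i\<in>I. V i) = {}"
      using insert.prems(2) insert.hyps by (auto simp: disjoint_family_on_def)
    have "Poly_Mapping.keys (sum a J) \<subseteq> (\<Union>i\<in>J. Poly_Mapping.keys (a i))" for J
    proof (induction J rule: infinite_finite_induct)
      case (insert j J)
      then show ?case using keys_add[of "a j" "sum a J"] by auto
    qed auto
    then show "Poly_Mapping.keys (\<Sum>i\<in>I. a i) \<subseteq> (\<Union>i\<in>I. V i)"
      by (rule order_trans) (rule UN_mono, use insert.prems(3) in auto)
  qed (use insert.prems in auto)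
  moreover have "disjoint_family_on V I"
    using insert.prems(2) by (auto simp: disjoint_family_on_def)
  then have "mcoeff (\<Prod>i\<in>I. p i) (\<Sum>i\<in>I. a i) = (\<Prod>i\<in>I. mcoeff (p i) (a i))"
    by (intro insert.IH) (simp_all add: insert.prems)
  ultimately show ?case
    by (simp only: prod.insert[OF insert.hyps] sum.insert[OF insert.hyps])
qed

lemma mcoeff_mconst_mult: "mcoeff (p * mconst c) m = mcoeff p m * c"
  for p :: "'a::comm_ring_1 mpolynomial"
  using mcoeff_mult_disjoint[of p UNIV "mconst c" "{}" m 0]
  by (simp add: in_polys_in_iff[of p]) (simp add: mcoeff_def mconst_def)

lemma mcoeff_mult_mvar: "mcoeff (p * mvar k) (m + Poly_Mapping.single k 1) = mcoeff p m"
  for p :: "'a::comm_ring_1 mpolynomial"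
proof -
  have "mcoeff (p * mvar k) (m + Poly_Mapping.single k 1)
      = (\<Sum>a\<in>Poly_Mapping.keys p. if a = m then mcoeff p m else 0)"
    unfolding mcoeff_mult by (simp add: mvar_def mcoeff_def cong: if_cong)
  then show ?thesis by (auto simp: mcoeff_def in_keys_iff)
qed

lemma lookup_squarefree_monomial:
  "finite T \<Longrightarrow> Poly_Mapping.lookup (squarefree_monomial T) k = (if k \<in> T then 1 else 0)"
  by (simp add: squarefree_monomial_def lookup_sum lookup_single when_def)

lemma keys_squarefree_monomial: "finite T \<Longrightarrow> Poly_Mapping.keys (squarefree_monomial T) = T"
  by (auto simp: in_keys_iff lookup_squarefree_monomial split: if_splits)

lemma squarefree_monomial_UN:
  assumes "finite I" "\<And>i. i \<in> I \<Longrightarrow> finite (V i)" "disjoint_family_on V I"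
  shows "squarefree_monomial (\<Union>i\<in>I. V i) = (\<Sum>i\<in>I. squarefree_monomial (V i))"
  unfolding squarefree_monomial_def using assms
  by (subst sum.UNION_disjoint) (auto simp: disjoint_family_on_def)

lemma squarefree_monomial_remove:
  "finite T \<Longrightarrow> k \<in> T \<Longrightarrow>
    squarefree_monomial T = squarefree_monomial (T - {k}) + Poly_Mapping.single k 1"
  unfolding squarefree_monomial_def by (subst sum.remove[of T k]) (simp_all add: add.commute)

subsection \<open>Setting a variable to zero\<close>

text \<open>Scaling \<open>x\<^sub>k\<close> by \<open>t\<close> is a ring homomorphism, hence so is the substitution \<open>x\<^sub>k = 0\<close> obtained at \<open>t = 0\<close>.\<close>

definition set_var_0 :: "nat \<Rightarrow> 'a::comm_ring_1 mpolynomial \<Rightarrow> 'a mpolynomial" where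
  "set_var_0 k p = poly (scale_outside (-{k}) p) 0"

lemma scale_outside_1 [simp]: "scale_outside V 1 = 1"
  using scale_outside_single[of V 0 1] by (simp add: outside_degree_def)

lemma set_var_0_hom: "comm_ring_hom (set_var_0 k)"
  by unfold_locales
    (auto simp: set_var_0_def scale_outside_add scale_outside_mult)

lemma mcoeff_set_var_0:
  "mcoeff (set_var_0 k p) m = (if Poly_Mapping.lookup m k = 0 then mcoeff p m else 0)"
proof -
  have "outside_degree (-{k}) m = Poly_Mapping.lookup m k"
    by (subst outside_degree_superset[of "insert k (Poly_Mapping.keys m)"]) (auto simp: Diff_insert_absorb)
  then show ?thesis
    by (simp add: mcoeff_def set_var_0_def poly_0_coeff_0 coeff_scale_outside)
qed

lemma set_var_0_in_polys_in: "p \<in> polys_in V \<Longrightarrow> set_var_0 k p \<in> polys_in V"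
  unfolding in_polys_in_iff by (auto simp: mcoeff_set_var_0 split: if_splits)

lemma set_var_0_id: "p \<in> polys_in (-{k}) \<Longrightarrow> set_var_0 k p = p"
  by (rule mpolynomial_eqI) (auto simp: mcoeff_set_var_0 mcoeff_eq_0)

lemma set_var_0_mvar: "set_var_0 k (mvar l) = (if l = k then 0 else mvar l)"
  by (rule mpolynomial_eqI)
    (auto simp: mcoeff_set_var_0, auto simp: mvar_def mcoeff_def lookup_single when_def)

lemma scale_outside_in_polys_in:
  assumes "p \<in> polys_in V"
  shows "scale_outside V p = [:p:]"
proof -
  have "Polynomial.degree (scale_outside V p) = 0"
    using assms by (simp add: degree_scale_outside_eq_0_iff)
  then obtain c where c: "scale_outside V p = [:c:]" by (meson degree_eq_zeroE)
  have "c = p"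
  proof (rule poly_mapping_eqI)
    fix m show "Poly_Mapping.lookup c m = Poly_Mapping.lookup p m"
      using coeff_scale_outside[of V p 0 m] assms
      by (auto simp: c polys_in_def outside_degree_eq_0_iff in_keys_iff split: if_splits)
  qed
  with c show ?thesis by simp
qed

text \<open>The product has degree at most \<open>1\<close> in \<open>x\<^sub>k\<close>, and degrees in \<open>x\<^sub>k\<close> add up.\<close>

lemma factor_free_of_variable:
  fixes g h :: "'a::idom mpolynomial"
  assumes gh: "g * h = mvar k * p + q" and p: "p \<in> polys_in (-{k})" and q: "q \<in> polys_in (-{k})"
    and nz: "g * h \<noteq> 0"
  shows "g \<in> polys_in (-{k}) \<or> h \<in> polys_in (-{k})"
proof -
  let ?s = "scale_outside (-{k}) :: 'a mpolynomial \<Rightarrow> _"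
  have "?s (mvar k) = Polynomial.monom (mvar k) (outside_degree (-{k}) (Poly_Mapping.single k 1))"
    unfolding mvar_def by (rule scale_outside_single)
  also have "outside_degree (-{k}) (Poly_Mapping.single k 1) = 1"
    by (simp add: outside_degree_def)
  finally have "?s (g * h) = Polynomial.monom (mvar k) 1 * [:p:] + [:q:]"
    using p q by (simp add: gh scale_outside_add scale_outside_mult scale_outside_in_polys_in)
  then have "?s g * ?s h = [:q, mvar k * p:]"
    by (simp add: scale_outside_mult monom_altdef)
  then have "Polynomial.degree (?s g * ?s h) \<le> 1"
    by (simp add: degree_pCons_eq_if)
  moreover have "?s g \<noteq> 0" "?s h \<noteq> 0"
    using nz by (auto simp: scale_outside_eq_0_iff)
  ultimately have "Polynomial.degree (?s g) = 0 \<or> Polynomial.degree (?s h) = 0"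
    by (auto simp: degree_mult_eq)
  then show ?thesis by (simp add: degree_scale_outside_eq_0_iff)
qed


section \<open>The determinant of a matrix with variables added on the diagonal\<close>

text \<open>The names \<open>v i\<close> of the variables are kept general, so that principal submatrices, whose variables are indexed by
  their set of rows, are treated together with the whole matrix.\<close>

definition var_mat :: "(nat \<Rightarrow> nat) \<Rightarrow> 'a::comm_ring_1 mat \<Rightarrow> 'a mpolynomial mat" where
  "var_mat v B = mat_diag (dim_row B) (\<lambda>i. mvar (v i)) + map_mat mconst B"

lemma var_mat_carrier [simp]: "B \<in> carrier_mat m m \<Longrightarrow> var_mat v B \<in> carrier_mat m m"
  by (auto simp: var_mat_def)

lemma var_mat_index:
  assumes "B \<in> carrier_mat m m" "i < m" "j < m"
  shows "var_mat v B $$ (i, j) = (if i = j then mvar (v j) else 0) + mconst (B $$ (i, j))"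
  using assms by (auto simp: var_mat_def mat_diag_def)

lemma var_mat_entry_free:
  assumes "B \<in> carrier_mat m m" "inj_on v {..<m}" "i < m" "j < m" "k < m" "k \<noteq> i \<or> k \<noteq> j"
  shows "var_mat v B $$ (i, j) \<in> polys_in (-{v k})"
  using assms by (auto simp: var_mat_index inj_on_eq_iff mvar_in_polys_in intro!: add_in_polys_in)

lemma det_var_mat_in_polys_in:
  assumes "B \<in> carrier_mat m m"
  shows "det (var_mat v B) \<in> polys_in (v ` {..<m})"
  using assms
  by (intro det_in_polys_in[of _ m]) (auto simp: var_mat_index mvar_in_polys_in intro!: add_in_polys_in)

lemma cofactor_var_mat_free:
  assumes B: "B \<in> carrier_mat m m" and v: "inj_on v {..<m}" and k: "k < m" and l: "l < m"
  shows "cofactor (var_mat v B) k l \<in> polys_in (-{v k})" "cofactor (var_mat v B) k l \<in> polys_in (-{v l})"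
proof -
  have minor: "det (mat_delete (var_mat v B) k l) \<in> polys_in (-{v p})" if p: "p = k \<or> p = l" for p
  proof (rule det_in_polys_in[of _ "m - 1"])
    fix i j assume "i < m - 1" "j < m - 1"
    moreover define r c where "r = (if i < k then i else Suc i)" and "c = (if j < l then j else Suc j)"
    ultimately have "mat_delete (var_mat v B) k l $$ (i, j) = var_mat v B $$ (r, c)"
      and "r < m" "c < m" "r \<noteq> k" "c \<noteq> l"
      using B by (auto simp: mat_delete_def var_mat_def mat_diag_def)
    with p k l show "mat_delete (var_mat v B) k l $$ (i, j) \<in> polys_in (-{v p})"
      using var_mat_entry_free[OF B v] by metis
  qed (rule mat_delete_carrier[OF var_mat_carrier[OF B]])
  have "(-1) ^ q * p \<in> polys_in V" if "p \<in> polys_in V" for p :: "'a mpolynomial" and q V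
    using that by (cases "even q") (auto intro: uminus_in_polys_in)
  then show "cofactor (var_mat v B) k l \<in> polys_in (-{v k})" "cofactor (var_mat v B) k l \<in> polys_in (-{v l})"
    using minor by (simp_all add: cofactor_def)
qed

lemma set_var_0_var_mat_index:
  assumes "B \<in> carrier_mat m m" "inj_on v {..<m}" "i < m" "j < m" "k < m"
  shows "set_var_0 (v k) (var_mat v B $$ (i, j)) = var_mat v B $$ (i, j) - (if i = k \<and> j = k then mvar (v k) else 0)"
proof (cases "i = k \<and> j = k")
  case True
  interpret comm_ring_hom "set_var_0 (v k) :: 'a mpolynomial \<Rightarrow> _" by (rule set_var_0_hom)
  show ?thesis
    using True assms by (simp add: var_mat_index hom_add set_var_0_mvar set_var_0_id)
next
  case False
  then show ?thesis
    using assms by (auto intro!: set_var_0_id var_mat_entry_free)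
qed

lemma set_var_0_free: "set_var_0 k p \<in> polys_in (-{k})"
  unfolding in_polys_in_iff by (auto simp: mcoeff_set_var_0 in_keys_iff split: if_splits)

lemma det_map_set_var_0: "det (map_mat (set_var_0 k) M) = set_var_0 k (det M)"
  by (rule comm_ring_hom.hom_det[OF set_var_0_hom])

text \<open>The determinant is affine in each variable, with the diagonal cofactor as slope.\<close>

lemma det_var_mat_expand:
  assumes B: "B \<in> carrier_mat m m" and v: "inj_on v {..<m}" and i: "i < m"
  shows "det (var_mat v B)
    = mvar (v i) * cofactor (var_mat v B) i i + set_var_0 (v i) (det (var_mat v B))"
proof -
  let ?M = "var_mat v B" and ?N = "map_mat (set_var_0 (v i)) (var_mat v B)"
  have N: "?N \<in> carrier_mat m m" and M: "?M \<in> carrier_mat m m" using B by auto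
  have eq: "?M = add_diag_entry i (mvar (v i)) ?N"
    using M i by (intro eq_matI) (auto simp: add_diag_entry_def set_var_0_var_mat_index[OF B v])
  have "det ?M = det ?N + mvar (v i) * cofactor ?N i i"
    by (subst eq) (rule det_add_diag_entry[OF N i])
  also have "cofactor ?N i i = cofactor ?M i i"
    using cofactor_add_diag_entry[OF N, of i i i "mvar (v i)"] unfolding eq[symmetric] by simp
  finally show ?thesis unfolding det_map_set_var_0 add.commute[of "set_var_0 _ _"] .
qed

lemma mcoeff_det_var_mat_cofactor:
  assumes B: "B \<in> carrier_mat m m" and v: "inj_on v {..<m}" and i: "i < m"
  shows "mcoeff (det (var_mat v B)) (squarefree_monomial (v ` {..<m}))
    = mcoeff (cofactor (var_mat v B) i i) (squarefree_monomial (v ` ({..<m} - {i})))"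
proof -
  have mono: "squarefree_monomial (v ` {..<m})
      = squarefree_monomial (v ` ({..<m} - {i})) + Poly_Mapping.single (v i) 1"
    using i v by (subst squarefree_monomial_remove[of _ "v i"]) (auto simp: inj_on_image_set_diff[of v "{..<m}"])
  have "mcoeff (set_var_0 (v i) (det (var_mat v B))) (squarefree_monomial (v ` {..<m})) = 0"
    using i by (simp add: mcoeff_set_var_0 lookup_squarefree_monomial)
  moreover have "mcoeff (mvar (v i) * cofactor (var_mat v B) i i) (squarefree_monomial (v ` {..<m}))
      = mcoeff (cofactor (var_mat v B) i i) (squarefree_monomial (v ` ({..<m} - {i})))"
    unfolding mono by (subst mult.commute) (rule mcoeff_mult_mvar)
  ultimately show ?thesis
    by (subst det_var_mat_expand[OF B v i]) (simp add: mcoeff_add)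
qed

text \<open>Only the diagonal product contributes to the product of all variables; by induction, the last variable is taken out
  with its cofactor.\<close>

lemma mcoeff_det_var_mat_top:
  assumes "B \<in> carrier_mat m m" "inj_on v {..<m}"
  shows "mcoeff (det (var_mat v B)) (squarefree_monomial (v ` {..<m})) = 1"
  using assms
proof (induction m arbitrary: B)
  case 0
  then have "det (var_mat v B) = 1" by (intro det_dim_zero) auto
  then show ?case by (simp add: squarefree_monomial_def mcoeff_def)
next
  case (Suc m)
  let ?B' = "mat m m (\<lambda>ij. B $$ ij)"
  have "mat_delete (var_mat v B) m m = var_mat v ?B'"
    using Suc.prems(1)
    by (intro eq_matI) (auto simp: mat_delete_def var_mat_index[of _ "Suc m"] var_mat_index[of ?B' m],
        auto simp: var_mat_def mat_diag_def)
  then have "cofactor (var_mat v B) m m = det (var_mat v ?B')"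
    by (simp add: cofactor_def)
  then show ?case
    using Suc mcoeff_det_var_mat_cofactor[OF Suc.prems, of m]
    by (simp add: lessThan_Suc)
qed

lemma det_var_mat_nonzero:
  assumes "B \<in> carrier_mat m m" "inj_on v {..<m}"
  shows "det (var_mat v B) \<noteq> 0"
  using mcoeff_det_var_mat_top[OF assms] by auto

subsection \<open>Nonzero entries of the adjugate\<close>

definition digraph_edges :: "'a::zero mat \<Rightarrow> (nat \<times> nat) set" where
  "digraph_edges B = {(i, j). i < dim_row B \<and> j < dim_row B \<and> B $$ (i, j) \<noteq> 0}"

text \<open>\<open>P\<close> is the vertex set of a path from \<open>i\<close> to \<open>k\<close> without shortcuts: the predecessor of a vertex is the
  only earlier vertex with an edge to it.\<close>

inductive induced_path :: "'a::zero mat \<Rightarrow> nat \<Rightarrow> nat set \<Rightarrow> nat \<Rightarrow> bool" for B i where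
  start: "induced_path B i {i} i"
| extend: "induced_path B i P k \<Longrightarrow> j < dim_row B \<Longrightarrow> j \<notin> P \<Longrightarrow> B $$ (k, j) \<noteq> 0 \<Longrightarrow>
    (\<And>k'. k' \<in> P - {k} \<Longrightarrow> B $$ (k', j) = 0) \<Longrightarrow> induced_path B i (insert j P) j"

lemma induced_path_vertices:
  assumes "induced_path B i P k" "i < dim_row B"
  shows "i \<in> P" "k \<in> P" "P \<subseteq> {..<dim_row B}"
  using assms by (induction rule: induced_path.induct) auto

lemma induced_path_to_vertex:
  "induced_path B i P k \<Longrightarrow> j \<in> P \<Longrightarrow> \<exists>P'. induced_path B i P' j"
  by (induction rule: induced_path.induct) (auto intro: induced_path.intros)

text \<open>Go along the path only up to its first vertex that has an edge to \<open>j\<close>, and then to \<open>j\<close>.\<close>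

lemma induced_path_via_edge:
  assumes "induced_path B i P k" "k' \<in> P" "B $$ (k', j) \<noteq> 0" "j \<notin> P" "j < dim_row B"
  shows "\<exists>P'. induced_path B i P' j"
  using assms
proof (induction arbitrary: k' rule: induced_path.induct)
  case start
  then have "induced_path B i (insert j {i}) j"
    by (intro induced_path.extend[OF induced_path.start]) auto
  then show ?case by blast
next
  case (extend P k l)
  show ?case
  proof (cases "\<exists>k''\<in>P. B $$ (k'', j) \<noteq> 0")
    case True
    then show ?thesis using extend.IH extend.prems by blast
  next
    case False
    have "induced_path B i (insert j (insert l P)) j"
      by (rule induced_path.extend[OF induced_path.extend[OF extend.hyps]])
        (use extend.prems False in auto)
    then show ?thesis by blast
  qed
qed

lemma reachable_imp_induced_path:
  assumes "(i, j) \<in> (digraph_edges B)\<^sup>*"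
  shows "\<exists>P. induced_path B i P j"
  using assms
proof (induction rule: rtrancl_induct)
  case base
  then show ?case using induced_path.start by blast
next
  case (step k j)
  then obtain P where P: "induced_path B i P k" by blast
  have "k \<in> P" using P by (cases rule: induced_path.cases) auto
  then show ?case
    using step.hyps(2) induced_path_to_vertex[OF P] induced_path_via_edge[OF P]
    by (cases "j \<in> P") (auto simp: digraph_edges_def)
qed

text \<open>Read off a coefficient in the entry \<open>(i, j)\<close> of \<open>adj M * M = det M\<close>, which lies off the diagonal. The monomial is the
  product of the variables outside \<open>P\<close>. It contains \<open>x\<^sub>l\<close> for \<open>l \<notin> P\<close>, whereas the cofactor of \<open>(l, i)\<close> does not; and
  no vertex of \<open>P\<close> other than \<open>k\<close> has an edge to \<open>j\<close>. So just two terms survive, one from the variable on the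
  diagonal and one from the edge \<open>k \<rightarrow> j\<close>.\<close>

lemma mcoeff_cofactor_extend:
  fixes B :: "'a::idom mat"
  assumes B: "B \<in> carrier_mat m m" and v: "inj_on v {..<m}"
    and P: "P \<subseteq> {..<m}" and i: "i \<in> P" and k: "k \<in> P" and j: "j < m" "j \<notin> P"
    and zero: "\<And>k'. k' \<in> P - {k} \<Longrightarrow> B $$ (k', j) = 0"
  shows "mcoeff (cofactor (var_mat v B) j i) (squarefree_monomial (v ` ({..<m} - insert j P)))
    = - (mcoeff (cofactor (var_mat v B) k i) (squarefree_monomial (v ` ({..<m} - P))) * B $$ (k, j))"
proof -
  let ?M = "var_mat v B" and ?Q = "squarefree_monomial (v ` ({..<m} - P))"
  let ?C = "\<lambda>k. cofactor (var_mat v B) k i"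
  have M: "?M \<in> carrier_mat m m" using B by simp
  have im: "i < m" and km: "k < m" and ij: "i \<noteq> j" using P i k j by auto
  have "v ` ({..<m} - P) - {v j} = v ` ({..<m} - insert j P)"
    using v j by (auto simp: inj_on_def)
  then have mono: "?Q = squarefree_monomial (v ` ({..<m} - insert j P)) + Poly_Mapping.single (v j) 1"
    using j by (subst squarefree_monomial_remove[of _ "v j"]) auto
  have "0 = (adj_mat ?M * ?M) $$ (i, j)"
    using adj_mat(3)[OF M] im j ij by simp
  also have "\<dots> = (\<Sum>l<m. adj_mat ?M $$ (i, l) * ?M $$ (l, j))"
    by (rule mult_mat_index_sum[OF adj_mat(1)[OF M] M im j(1)])
  also have "\<dots> = (\<Sum>l<m. (if l = j then ?C j * mvar (v j) else 0) + ?C l * mconst (B $$ (l, j)))"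
    using im j by (intro sum.cong) (auto simp: adj_mat_index[OF M] var_mat_index[OF B] algebra_simps)
  also have "\<dots> = ?C j * mvar (v j) + (\<Sum>l<m. ?C l * mconst (B $$ (l, j)))"
    using j by (simp add: sum.distrib)
  finally have "0 = mcoeff (?C j * mvar (v j) + (\<Sum>l<m. ?C l * mconst (B $$ (l, j)))) ?Q"
    by (metis mcoeff_0)
  also have "\<dots> = mcoeff (?C j) (squarefree_monomial (v ` ({..<m} - insert j P)))
      + (\<Sum>l<m. mcoeff (?C l) ?Q * B $$ (l, j))"
    by (simp add: mcoeff_add mcoeff_sum mcoeff_mconst_mult) (simp add: mono mcoeff_mult_mvar[simplified])
  also have "(\<Sum>l<m. mcoeff (?C l) ?Q * B $$ (l, j)) = (\<Sum>l<m. if l = k then mcoeff (?C k) ?Q * B $$ (k, j) else 0)"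
  proof (rule sum.cong)
    fix l assume l: "l \<in> {..<m}"
    show "mcoeff (?C l) ?Q * B $$ (l, j) = (if l = k then mcoeff (?C k) ?Q * B $$ (k, j) else 0)"
    proof (cases "l \<in> P")
      case True
      then show ?thesis using zero by auto
    next
      case False
      then have "mcoeff (?C l) ?Q = 0"
        using l im by (intro mcoeff_eq_0[OF cofactor_var_mat_free(1)[OF B v]])
          (auto simp: lookup_squarefree_monomial)
      with False k show ?thesis by auto
    qed
  qed simp
  finally show ?thesis using km by (simp add: eq_neg_iff_add_eq_0)
qed

text \<open>Along an induced path the coefficient of the complementary monomial starts at \<open>1\<close> and is multiplied by minus the
  weight of each edge, hence never vanishes.\<close>

lemma cofactor_var_mat_nonzero:
  fixes B :: "'a::idom mat"
  assumes B: "B \<in> carrier_mat m m" and v: "inj_on v {..<m}" and i: "i < m"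
    and path: "(i, j) \<in> (digraph_edges B)\<^sup>*"
  shows "cofactor (var_mat v B) j i \<noteq> 0"
proof -
  obtain P where P: "induced_path B i P j"
    using reachable_imp_induced_path[OF path] by blast
  have "mcoeff (cofactor (var_mat v B) j i) (squarefree_monomial (v ` ({..<m} - P))) \<noteq> 0"
    using P
  proof (induction rule: induced_path.induct)
    case start
    then show ?case
      using mcoeff_det_var_mat_cofactor[OF B v i] mcoeff_det_var_mat_top[OF B v] by simp
  next
    case (extend P k j)
    have "i < dim_row B" using B i by simp
    note vert = induced_path_vertices[OF extend.hyps(1) this]
    have "mcoeff (cofactor (var_mat v B) j i) (squarefree_monomial (v ` ({..<m} - insert j P)))
      = - (mcoeff (cofactor (var_mat v B) k i) (squarefree_monomial (v ` ({..<m} - P))) * B $$ (k, j))"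
      using vert extend.hyps B by (intro mcoeff_cofactor_extend[OF B v]) auto
    then show ?case using extend.IH extend.hyps(4) by simp
  qed
  then show ?thesis by auto
qed

subsection \<open>Factorizations\<close>

text \<open>Apply \<open>det_two_diag_entries\<close> to the matrix \<open>N\<close> with both variables set to zero. Because \<open>g\<close> and \<open>h\<close>
  each contain at most one of the two variables, the four determinants form a product table, so the product of the two
  mixed cofactors is zero, although the paths make both of them nonzero.\<close>

lemma factors_separate_no_cycle:
  fixes B :: "'a::idom mat"
  assumes B: "B \<in> carrier_mat m m" and v: "inj_on v {..<m}" and i: "i < m" and j: "j < m"
    and ij: "i \<noteq> j"
    and gh: "det (var_mat v B) = g * h"
    and g: "g \<in> polys_in (-{v j})" and h: "h \<in> polys_in (-{v i})"
    and path: "(i, j) \<in> (digraph_edges B)\<^sup>*" "(j, i) \<in> (digraph_edges B)\<^sup>*"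
  shows False
proof -
  let ?\<theta>i = "set_var_0 (v i) :: 'a mpolynomial \<Rightarrow> _" and ?\<theta>j = "set_var_0 (v j) :: 'a mpolynomial \<Rightarrow> _"
  interpret hi: comm_ring_hom ?\<theta>i by (rule set_var_0_hom)
  interpret hj: comm_ring_hom ?\<theta>j by (rule set_var_0_hom)
  let ?M = "var_mat v B"
  let ?N = "map_mat ?\<theta>i (map_mat ?\<theta>j ?M)"
  have M: "?M \<in> carrier_mat m m" and N: "?N \<in> carrier_mat m m" using B by auto
  have vij: "v i \<noteq> v j" using v i j ij by (auto simp: inj_on_def)
  note ix = set_var_0_var_mat_index[OF B v]
  have ti: "?\<theta>i (mvar (v j)) = mvar (v j)" using vij by (simp add: set_var_0_mvar)
  have N_index: "?N $$ (p, q) = ?M $$ (p, q) - (if p = i \<and> q = i then mvar (v i) else 0)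
      - (if p = j \<and> q = j then mvar (v j) else 0)" if "p < m" "q < m" for p q
  proof -
    have "?N $$ (p, q) = ?\<theta>i (?\<theta>j (?M $$ (p, q)))"
      using that M by auto
    also have "\<dots> = ?\<theta>i (?M $$ (p, q)) - ?\<theta>i (if p = j \<and> q = j then mvar (v j) else 0)"
      using that i j by (simp only: ix hi.hom_minus)
    finally show ?thesis
      using that i j ti by (simp add: ix)
  qed
  have Mi: "add_diag_entry i (mvar (v i)) ?N = map_mat ?\<theta>j ?M"
  proof (rule eq_matI)
    fix p q assume "p < dim_row (map_mat ?\<theta>j ?M)" "q < dim_col (map_mat ?\<theta>j ?M)"
    then have "p < m" "q < m" using M by auto
    then show "add_diag_entry i (mvar (v i)) ?N $$ (p, q) = map_mat ?\<theta>j ?M $$ (p, q)"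
      using M j ij by (simp only: add_diag_entry_index[OF N] N_index) (auto simp: ix)
  qed (use M in \<open>auto simp: add_diag_entry_def\<close>)
  have Mj: "add_diag_entry j (mvar (v j)) ?N = map_mat ?\<theta>i ?M"
  proof (rule eq_matI)
    fix p q assume "p < dim_row (map_mat ?\<theta>i ?M)" "q < dim_col (map_mat ?\<theta>i ?M)"
    then have "p < m" "q < m" using M by auto
    then show "add_diag_entry j (mvar (v j)) ?N $$ (p, q) = map_mat ?\<theta>i ?M $$ (p, q)"
      using M i ij by (simp only: add_diag_entry_index[OF N] N_index) (auto simp: ix)
  qed (use M in \<open>auto simp: add_diag_entry_def\<close>)
  have Mij: "add_diag_entry j (mvar (v j)) (map_mat ?\<theta>j ?M) = ?M"
    using M i j
    by (intro eq_matI) (auto simp: add_diag_entry_index[of _ m] ix, auto simp: add_diag_entry_def)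
  have C: "cofactor ?N k l = cofactor ?M k l" if "k = i \<and> l = j \<or> k = j \<and> l = i" for k l
    by (rule cofactor_cong[OF N M]) (use that in \<open>auto simp: N_index simp del: index_map_mat\<close>)
  have "?\<theta>j (det ?M) * ?\<theta>i (det ?M) = ?\<theta>i (?\<theta>j (det ?M)) * det ?M
      + mvar (v i) * mvar (v j) * cofactor ?M i j * cofactor ?M j i"
    using det_two_diag_entries[OF N i j ij, of "mvar (v i)" "mvar (v j)"]
    by (simp add: Mi Mj Mij C det_map_set_var_0)
  moreover have "?\<theta>i (?\<theta>j (det ?M)) = ?\<theta>i g * ?\<theta>j h"
    using set_var_0_id[OF g] set_var_0_id[OF set_var_0_in_polys_in[OF h, of "v j"]]
    by (simp add: gh hi.hom_mult hj.hom_mult)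
  moreover have "?\<theta>j (det ?M) = g * ?\<theta>j h" "?\<theta>i (det ?M) = ?\<theta>i g * h"
    using set_var_0_id[OF g] set_var_0_id[OF h] by (simp_all add: gh hi.hom_mult hj.hom_mult)
  ultimately have "mvar (v i) * mvar (v j) * cofactor ?M i j * cofactor ?M j i = 0"
    by (simp add: gh algebra_simps)
  moreover have "mvar k \<noteq> (0 :: 'a mpolynomial)" for k
    by (metis lookup_single_eq lookup_zero mvar_def zero_neq_one)
  ultimately show False
    using cofactor_var_mat_nonzero[OF B v i path(1)] cofactor_var_mat_nonzero[OF B v j path(2)] by simp
qed

text \<open>Each variable occurs in exactly one of two factors. By strong connectivity and \<open>factors_separate_no_cycle\<close>
  it is the same factor for all of them, and the other factor is constant.\<close>

lemma irreducible_det_var_mat: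
  fixes B :: "'a::field mat"
  assumes B: "B \<in> carrier_mat m m" and v: "inj_on v {..<m}" and m: "0 < m"
    and conn: "\<And>i j. i < m \<Longrightarrow> j < m \<Longrightarrow> (i, j) \<in> (digraph_edges B)\<^sup>*"
  shows "irreducible (det (var_mat v B))"
proof (rule irreducibleI)
  let ?f = "det (var_mat v B)"
  show nz: "?f \<noteq> 0" by (rule det_var_mat_nonzero[OF B v])
  have dep: "?f \<notin> polys_in (-{v i})" if "i < m" for i
    using mcoeff_det_var_mat_top[OF B v] mcoeff_eq_0[of ?f "v i" "squarefree_monomial (v ` {..<m})"] that
    by (auto simp: lookup_squarefree_monomial)
  show "\<not> ?f dvd 1"
    using dep[OF m] mult_in_polys_in_iff[of ?f _ "-{v 0}"] one_in_polys_in by (metis dvdE zero_neq_one)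
  fix g h assume gh: "?f = g * h"
  have one: "g \<in> polys_in (-{v i}) \<longleftrightarrow> h \<notin> polys_in (-{v i})" if "i < m" for i
  proof -
    have "g \<in> polys_in (-{v i}) \<or> h \<in> polys_in (-{v i})"
    proof (rule factor_free_of_variable)
      show "g * h = mvar (v i) * cofactor (var_mat v B) i i + set_var_0 (v i) ?f"
        using det_var_mat_expand[OF B v that] by (simp only: gh)
    qed (use nz gh in \<open>simp_all add: cofactor_var_mat_free[OF B v that that] set_var_0_free\<close>)
    moreover have "\<not> (g \<in> polys_in (-{v i}) \<and> h \<in> polys_in (-{v i}))"
      using dep[OF that] mult_in_polys_in by (auto simp: gh)
    ultimately show ?thesis by blast
  qed
  have supp: "g \<in> polys_in (v ` {..<m})" "h \<in> polys_in (v ` {..<m})"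
    using det_var_mat_in_polys_in[OF B, of v] mult_in_polys_in_iff[of g h] nz by (auto simp: gh)
  have const: "p dvd 1" if "p \<in> polys_in (v ` {..<m})" "\<And>i. i < m \<Longrightarrow> p \<in> polys_in (-{v i})" "p \<noteq> 0"
    for p :: "'a mpolynomial"
  proof (rule polys_in_empty_unit)
    show "p \<in> polys_in {}"
      using that(1,2) unfolding polys_in_def by fast
  qed (rule that(3))
  have "(\<forall>i<m. g \<in> polys_in (-{v i})) \<or> (\<forall>i<m. h \<in> polys_in (-{v i}))"
  proof (rule ccontr)
    assume "\<not> ?thesis"
    then obtain i j where ij: "i < m" "j < m" "g \<notin> polys_in (-{v i})" "h \<notin> polys_in (-{v j})" by blast
    then have "g \<in> polys_in (-{v j})" "h \<in> polys_in (-{v i})" "i \<noteq> j" using one by auto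
    then show False
      using factors_separate_no_cycle[OF B v ij(1,2) _ gh] conn ij by blast
  qed
  then show "g dvd 1 \<or> h dvd 1"
    using const supp nz by (auto simp: gh)
qed


section \<open>Block triangular form and ordered partitions\<close>

subsection \<open>Principal submatrices\<close>

lemma map_pick_upt:
  assumes "finite S"
  shows "map (pick S) [0..<card S] = sorted_list_of_set S"
proof -
  let ?l = "map (pick S) [0..<card S]"
  have less: "pick S i < pick S j" if "i < j" "j < card S" for i j
    using that pick_mono_le by blast
  have inj: "inj_on (pick S) {0..<card S}"
    by (rule linorder_inj_onI) (use less in \<open>auto simp: less_imp_neq\<close>)
  have "pick S ` {0..<card S} = S"
    using assms inj by (intro card_subset_eq) (auto simp: card_image pick_in_set_le)
  then have "set ?l = S" by simp
  moreover have "sorted ?l" "distinct ?l"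
    using inj less by (auto simp: distinct_map sorted_map intro!: sorted_wrt_iff_nth_less[THEN iffD2] less_imp_le)
  ultimately show ?thesis
    by (metis sorted_list_of_set.idem_if_sorted_distinct)
qed

lemma pick_eq_nth: "finite S \<Longrightarrow> i < card S \<Longrightarrow> pick S i = sorted_list_of_set S ! i"
  using arg_cong[OF map_pick_upt, of S "\<lambda>l. l ! i"] by simp

lemma bij_betw_pick: "finite S \<Longrightarrow> bij_betw (pick S) {..<card S} S"
proof -
  assume "finite S"
  then have "bij_betw ((!) (sorted_list_of_set S)) {..<card S} S"
    by (intro bij_betw_nth) auto
  then show ?thesis
    using \<open>finite S\<close> by (subst bij_betw_cong[where g = "(!) (sorted_list_of_set S)"]) (auto simp: pick_eq_nth)
qed

lemma principal_submatrix_eq: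
  assumes "A \<in> carrier_mat n n" "S \<subseteq> {..<n}"
  shows "principal_submatrix A S = mat (card S) (card S) (\<lambda>(i, j). A $$ (pick S i, pick S j))"
proof -
  have "{i. i < n \<and> i \<in> S} = S" using assms(2) by auto
  then show ?thesis using assms(1) by (simp add: principal_submatrix_def submatrix_def)
qed

lemma principal_submatrix_carrier:
  "A \<in> carrier_mat n n \<Longrightarrow> S \<subseteq> {..<n} \<Longrightarrow> principal_submatrix A S \<in> carrier_mat (card S) (card S)"
  by (simp add: principal_submatrix_eq)

lemma pick_lessThan: "i < n \<Longrightarrow> pick {..<n} i = i"
  by (simp add: pick_eq_nth lessThan_atLeast0)

lemma pick_atLeastLessThan: "i < u - l \<Longrightarrow> pick {l..<u} i = l + i"
  by (simp add: pick_eq_nth)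

lemma principal_submatrix_all: "A \<in> carrier_mat n n \<Longrightarrow> principal_submatrix A {..<n} = A"
  by (auto simp: principal_submatrix_eq pick_lessThan intro!: eq_matI)

subsection \<open>Block indices\<close>

lemma block_indices_shift:
  "k < length ds \<Longrightarrow> block_indices ds k = (\<lambda>a. sum_list (take k ds) + a) ` {..<ds ! k}"
  by (simp add: block_indices_def take_Suc_conv_app_nth lessThan_atLeast0 image_add_atLeastLessThan add.commute)

lemma sum_list_take_mono: "l \<le> k \<Longrightarrow> sum_list (take l ds) \<le> sum_list (take k ds)" for ds :: "nat list"
  by (metis le_add1 le_iff_add sum_list_append take_add)

lemma UN_block_indices: "(\<Union>k<length ds. block_indices ds k) = {..<sum_list ds}"
proof -
  have "(\<Union>k<j. block_indices ds k) = {..<sum_list (take j ds)}" for j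
  proof (induction j)
    case (Suc j)
    then show ?case
      using sum_list_take_mono[of j "Suc j" ds]
      by (auto simp: lessThan_Suc block_indices_def)
  qed simp
  from this[of "length ds"] show ?thesis by simp
qed

lemma block_indices_disjoint:
  assumes "l < k"
  shows "block_indices ds l \<inter> block_indices ds k = {}"
  using sum_list_take_mono[of "Suc l" k ds] assms by (auto simp: block_indices_def)

text \<open>Block triangular forms of \<open>A[S,S]\<close> up to the order inside the blocks, described by the index sets of the blocks
  instead of a permutation; in this form blocks can be refined and merged without renumbering.\<close>

definition triangular_partition :: "'a::zero mat \<Rightarrow> nat set \<Rightarrow> nat set list \<Rightarrow> bool" where
  "triangular_partition A S Ss \<longleftrightarrow> \<Union>(set Ss) = S \<and> {} \<notin> set Ss \<and>
     sorted_wrt (\<lambda>X Y. X \<inter> Y = {} \<and> (\<forall>i\<in>Y. \<forall>j\<in>X. A $$ (i, j) = 0)) Ss"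

lemma triangular_partition_distinct:
  "triangular_partition A S Ss \<Longrightarrow> distinct Ss"
  unfolding triangular_partition_def
  by (auto simp: distinct_conv_nth sorted_wrt_iff_nth_less) (metis Int_absorb linorder_neqE_nat nth_mem)

lemma triangular_partition_disjoint:
  assumes "triangular_partition A S Ss" "X \<in> set Ss" "Y \<in> set Ss" "X \<noteq> Y"
  shows "X \<inter> Y = {}"
proof -
  obtain i j where "i < length Ss" "j < length Ss" "X = Ss ! i" "Y = Ss ! j"
    using assms(2,3) by (metis in_set_conv_nth)
  with assms show ?thesis
    unfolding triangular_partition_def sorted_wrt_iff_nth_less
    by (metis inf_commute linorder_neqE_nat)
qed

text \<open>The permutation lists the blocks one after the other, each in increasing order. The increasing order makes the
  diagonal blocks equal to the principal submatrices, not just permuted copies of them.\<close>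

lemma triangular_partition_permutation:
  assumes A: "A \<in> carrier_mat n n" and Ss: "triangular_partition A {..<n} Ss"
  obtains \<sigma> where "\<sigma> permutes {..<n}" "block_upper_triangular (map card Ss) (permute_mat \<sigma> A)"
    "\<And>k. k < length Ss \<Longrightarrow> \<sigma> ` block_indices (map card Ss) k = Ss ! k"
    "\<And>k. k < length Ss \<Longrightarrow> principal_submatrix (permute_mat \<sigma> A) (block_indices (map card Ss) k)
       = principal_submatrix A (Ss ! k)"
proof -
  let ?ds = "map card Ss" and ?xs = "concat (map sorted_list_of_set Ss)"
  define \<sigma> where "\<sigma> i = (if i < n then ?xs ! i else i)" for i
  have sub: "X \<subseteq> {..<n}" "finite X" if "X \<in> set Ss" for X
    using Ss that finite_subset[of X "{..<n}"] by (auto simp: triangular_partition_def)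
  have set: "set ?xs = {..<n}"
    using Ss sub(2) by (auto simp: triangular_partition_def)
  have dist: "distinct ?xs"
  proof (rule distinct_concat)
    show "distinct (map sorted_list_of_set Ss)"
      using triangular_partition_distinct[OF Ss] sub(2)
      by (auto simp: distinct_map inj_on_def) (metis set_sorted_list_of_set)+
    show "set ys \<inter> set zs = {}"
      if "ys \<in> set (map sorted_list_of_set Ss)" "zs \<in> set (map sorted_list_of_set Ss)" "ys \<noteq> zs" for ys zs
      using that triangular_partition_disjoint[OF Ss] sub(2) by (auto simp: disjoint_iff) metis
  qed auto
  have len: "length ?xs = n"
    using distinct_card[OF dist] set by simp
  have sum: "sum_list ?ds = n"
    using len by (simp add: length_concat comp_def)
  have "bij_betw ((!) ?xs) {..<n} {..<n}"
    by (rule bij_betw_nth[OF dist]) (simp_all only: set len)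
  then have "bij_betw \<sigma> {..<n} {..<n}"
    by (rule bij_betw_cong[THEN iffD1, rotated]) (simp add: \<sigma>_def)
  then have perm: "\<sigma> permutes {..<n}"
    by (intro bij_imp_permutes) (auto simp: \<sigma>_def)
  have \<sigma>_block: "\<sigma> (sum_list (take k ?ds) + a) = sorted_list_of_set (Ss ! k) ! a"
    if k: "k < length Ss" and a: "a < card (Ss ! k)" for k a
  proof -
    let ?p = "concat (map sorted_list_of_set (take k Ss))"
    have lp: "length ?p = sum_list (take k ?ds)"
      by (simp add: length_concat comp_def take_map)
    have "?xs = ?p @ sorted_list_of_set (Ss ! k) @ concat (map sorted_list_of_set (drop (Suc k) Ss))"
      by (subst id_take_nth_drop[OF k]) simp
    then have "?xs ! (sum_list (take k ?ds) + a) = sorted_list_of_set (Ss ! k) ! a"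
      using a by (simp add: lp[symmetric] nth_append)
    moreover have "sum_list (take k ?ds) + a < n"
      using sum_list_take_mono[of "Suc k" "length ?ds" ?ds] k a
      by (simp add: sum take_Suc_conv_app_nth)
    ultimately show ?thesis by (simp add: \<sigma>_def)
  qed
  have image: "\<sigma> ` block_indices ?ds k = Ss ! k" if k: "k < length Ss" for k
  proof -
    have fin: "finite (Ss ! k)" using sub(2) k by simp
    have "\<sigma> ` block_indices ?ds k = (!) (sorted_list_of_set (Ss ! k)) ` {..<card (Ss ! k)}"
      using k by (force simp: block_indices_shift image_image \<sigma>_block)
    also have "\<dots> = Ss ! k"
      using bij_betw_imp_surj_on[OF bij_betw_nth[of "sorted_list_of_set (Ss ! k)"]] fin by simp
    finally show ?thesis .
  qed
  have in_n: "block_indices ?ds k \<subseteq> {..<n}" if "k < length Ss" for k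
    using UN_block_indices[of ?ds] that by (auto simp: sum)
  have PA: "permute_mat \<sigma> A \<in> carrier_mat n n" using A by (simp add: permute_mat_def)
  have PA_index: "permute_mat \<sigma> A $$ (i, j) = A $$ (\<sigma> i, \<sigma> j)" if "i < n" "j < n" for i j
    using A that by (simp add: permute_mat_def)
  show ?thesis
  proof (rule that[OF perm _ image])
    show "block_upper_triangular ?ds (permute_mat \<sigma> A)"
      unfolding block_upper_triangular_def
    proof (intro conjI allI impI ballI)
      show "permute_mat \<sigma> A \<in> carrier_mat (sum_list ?ds) (sum_list ?ds)"
        using PA by (simp add: sum)
      show "0 < d" if "d \<in> set ?ds" for d
        using that Ss sub(2) by (auto simp: triangular_partition_def card_gt_0_iff)
      fix k l i j assume *: "k < length ?ds" "l < k" "i \<in> block_indices ?ds k" "j \<in> block_indices ?ds l"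
      then have "i < n" "j < n" "\<sigma> i \<in> Ss ! k" "\<sigma> j \<in> Ss ! l"
        using in_n[of k] in_n[of l] image[of k] image[of l] by auto
      then show "permute_mat \<sigma> A $$ (i, j) = 0"
        using Ss * by (simp add: PA_index triangular_partition_def sorted_wrt_iff_nth_less)
    qed
    fix k assume k: "k < length Ss"
    have c: "card (block_indices ?ds k) = card (Ss ! k)"
      using k by (simp add: block_indices_def take_Suc_conv_app_nth)
    have pk: "pick (block_indices ?ds k) a = sum_list (take k ?ds) + a" if "a < card (Ss ! k)" for a
      using that k by (simp add: block_indices_def pick_atLeastLessThan take_Suc_conv_app_nth)
    have lt: "sum_list (take k ?ds) + a < n" if "a < card (Ss ! k)" for a
      using that in_n[OF k] k by (auto simp: block_indices_shift)
    have "Ss ! k \<in> set Ss" using k by simp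
    note sub = sub[OF this]
    show "principal_submatrix (permute_mat \<sigma> A) (block_indices ?ds k) = principal_submatrix A (Ss ! k)"
      unfolding principal_submatrix_eq[OF PA in_n[OF k]] principal_submatrix_eq[OF A sub(1)] c
      by (rule eq_matI) (auto simp: pk lt PA_index \<sigma>_block[OF k] pick_eq_nth[OF sub(2)])
  qed
qed

lemma block_upper_triangular_partition:
  assumes A: "A \<in> carrier_mat n n" and \<sigma>: "\<sigma> permutes {..<n}"
    and tri: "block_upper_triangular ds (permute_mat \<sigma> A)"
  shows "triangular_partition A {..<n} (map (\<lambda>k. \<sigma> ` block_indices ds k) [0..<length ds])"
proof -
  have sum: "sum_list ds = n"
    using tri A by (auto simp: block_upper_triangular_def permute_mat_def)
  have in_n: "block_indices ds k \<subseteq> {..<n}" if "k < length ds" for k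
    using UN_block_indices[of ds] that by (auto simp: sum)
  have "(\<Union>k<length ds. \<sigma> ` block_indices ds k) = {..<n}"
    unfolding image_UN[symmetric] UN_block_indices sum by (rule permutes_image[OF \<sigma>])
  moreover have "block_indices ds k \<noteq> {}" if "k < length ds" for k
    using that tri by (auto simp: block_indices_shift block_upper_triangular_def)
  moreover have "\<sigma> ` block_indices ds l \<inter> \<sigma> ` block_indices ds k = {}" if "l < k" for k l
    using block_indices_disjoint[OF that, of ds] permutes_inj[OF \<sigma>]
    by (metis image_Int image_empty)
  moreover have "A $$ (\<sigma> i, \<sigma> j) = 0"
    if "l < k" "k < length ds" "i \<in> block_indices ds k" "j \<in> block_indices ds l" for k l i j
  proof -
    have "permute_mat \<sigma> A $$ (i, j) = 0"
      using that tri by (auto simp: block_upper_triangular_def)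
    moreover have "i < n" "j < n" using that in_n[of k] in_n[of l] by auto
    ultimately show ?thesis using A by (simp add: permute_mat_def)
  qed
  ultimately show ?thesis
    by (auto simp: triangular_partition_def sorted_wrt_iff_nth_less lessThan_atLeast0)
qed

lemma reducible_mat_iff_partition:
  assumes A: "A \<in> carrier_mat n n"
  shows "reducible_mat A \<longleftrightarrow> (\<exists>Ss. triangular_partition A {..<n} Ss \<and> 2 \<le> length Ss)"
proof
  assume "reducible_mat A"
  then obtain \<sigma> ds where *: "\<sigma> permutes {..<n}" "2 \<le> length ds" "block_upper_triangular ds (permute_mat \<sigma> A)"
    using A by (auto simp: reducible_mat_def)
  have "2 \<le> length (map (\<lambda>k. \<sigma> ` block_indices ds k) [0..<length ds])"
    using *(2) by simp
  then show "\<exists>Ss. triangular_partition A {..<n} Ss \<and> 2 \<le> length Ss"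
    using block_upper_triangular_partition[OF A *(1,3)] by blast
next
  assume "\<exists>Ss. triangular_partition A {..<n} Ss \<and> 2 \<le> length Ss"
  then obtain Ss where Ss: "triangular_partition A {..<n} Ss" "2 \<le> length Ss" by blast
  show "reducible_mat A"
    by (rule triangular_partition_permutation[OF A Ss(1)])
      (use A Ss(2) in \<open>auto simp: reducible_mat_def intro!: exI[of _ "map card Ss"]\<close>)
qed

text \<open>The vertices reachable from \<open>i\<close> have no edge to the others, so they would form the last block of a
  triangular form with two blocks if \<open>j\<close> were not among them.\<close>

lemma irreducible_mat_strongly_connected:
  assumes B: "B \<in> carrier_mat m m" and irr: "irreducible_mat B" and i: "i < m" and j: "j < m"
  shows "(i, j) \<in> (digraph_edges B)\<^sup>*"
proof (rule ccontr)
  assume not: "(i, j) \<notin> (digraph_edges B)\<^sup>*"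
  define R where "R = {k. k < m \<and> (i, k) \<in> (digraph_edges B)\<^sup>*}"
  have zero: "B $$ (k, l) = 0" if "k \<in> R" "l \<in> {..<m} - R" for k l
  proof (rule ccontr)
    assume "B $$ (k, l) \<noteq> 0"
    then have "(k, l) \<in> digraph_edges B"
      using that B by (auto simp: R_def digraph_edges_def)
    then show False
      using that rtrancl.rtrancl_into_rtrancl[of i k "digraph_edges B" l] by (auto simp: R_def)
  qed
  have "i \<in> R" "j \<in> {..<m} - R" "R \<subseteq> {..<m}" using i j not by (auto simp: R_def)
  then have "triangular_partition B {..<m} [{..<m} - R, R]"
    using zero by (auto simp: triangular_partition_def)
  then have "reducible_mat B"
    using reducible_mat_iff_partition[OF B] by fastforce
  then show False using irr by (simp add: irreducible_mat_def)
qed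

lemma triangular_partition_append:
  assumes "triangular_partition A S [X, Y]" "triangular_partition A X Xs" "triangular_partition A Y Ys"
  shows "triangular_partition A S (Xs @ Ys)"
proof -
  have "X' \<inter> Y' = {} \<and> (\<forall>i\<in>Y'. \<forall>j\<in>X'. A $$ (i, j) = 0)" if "X' \<in> set Xs" "Y' \<in> set Ys" for X' Y'
  proof -
    have "X' \<subseteq> X" "Y' \<subseteq> Y" using that assms(2,3) by (auto simp: triangular_partition_def)
    moreover have "X \<inter> Y = {}" "\<forall>i\<in>Y. \<forall>j\<in>X. A $$ (i, j) = 0"
      using assms(1) by (simp_all add: triangular_partition_def)
    ultimately show ?thesis by blast
  qed
  then show ?thesis
    using assms by (auto simp: triangular_partition_def sorted_wrt_append)
qed

lemma triangular_partition_split: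
  assumes A: "A \<in> carrier_mat n n" and S: "S \<subseteq> {..<n}"
    and red: "\<not> irreducible_mat (principal_submatrix A S)"
  obtains X Y where "triangular_partition A S [X, Y]"
proof -
  let ?B = "principal_submatrix A S"
  have fin: "finite S" using S finite_subset by blast
  have B: "?B \<in> carrier_mat (card S) (card S)" by (rule principal_submatrix_carrier[OF A S])
  have "reducible_mat ?B" using red B by (auto simp: irreducible_mat_def)
  then obtain Ss where Ss: "triangular_partition ?B {..<card S} Ss" "2 \<le> length Ss"
    using reducible_mat_iff_partition[OF B] by blast
  then obtain X Xs where Xs: "Ss = X # Xs" "Xs \<noteq> []"
    using Ss(2) by (cases Ss; cases "tl Ss") auto
  define Y where "Y = \<Union>(set Xs)"
  have XY: "X \<union> Y = {..<card S}" "X \<inter> Y = {}" "X \<noteq> {}" "Y \<noteq> {}"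
    and zero: "\<And>i j. i \<in> Y \<Longrightarrow> j \<in> X \<Longrightarrow> ?B $$ (i, j) = 0"
    using Ss Xs by (auto simp: triangular_partition_def Y_def neq_Nil_conv)
  have inj: "inj_on (pick S) {..<card S}" and img: "pick S ` {..<card S} = S"
    using bij_betw_pick[OF fin] by (auto simp: bij_betw_def)
  have "A $$ (pick S i, pick S j) = 0" if "i \<in> Y" "j \<in> X" for i j
  proof -
    have "i < card S" "j < card S" using that XY(1) by blast+
    then show ?thesis using zero[OF that] by (simp add: principal_submatrix_eq[OF A S])
  qed
  moreover have "pick S ` X \<inter> pick S ` Y = {}"
    using inj_on_image_Int[OF inj, of X Y] XY by auto
  moreover have "pick S ` X \<union> pick S ` Y = S"
    using img XY(1) by (metis image_Un)
  ultimately have "triangular_partition A S [pick S ` X, pick S ` Y]"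
    using XY by (auto simp: triangular_partition_def)
  then show ?thesis by (rule that)
qed

text \<open>Split reducible blocks as long as there are any.\<close>

lemma triangular_partition_irreducible_blocks:
  assumes A: "A \<in> carrier_mat n n" and "S \<subseteq> {..<n}"
  shows "\<exists>Ss. triangular_partition A S Ss \<and> (\<forall>X\<in>set Ss. irreducible_mat (principal_submatrix A X))"
  using assms(2)
proof (induction "card S" arbitrary: S rule: less_induct)
  case less
  consider "S = {}" | "S \<noteq> {}" "irreducible_mat (principal_submatrix A S)"
    | "\<not> irreducible_mat (principal_submatrix A S)" by blast
  then show ?case
  proof cases
    case 1
    then have "triangular_partition A S []" by (simp add: triangular_partition_def)
    then show ?thesis by (intro exI[of _ "[]"]) simp
  next
    case 2
    then have "triangular_partition A S [S]" by (simp add: triangular_partition_def)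
    with 2 show ?thesis by (intro exI[of _ "[S]"]) simp
  next
    case 3
    then obtain X Y where XY: "triangular_partition A S [X, Y]"
      using triangular_partition_split[OF A less.prems] by blast
    then have "X \<subset> S" "Y \<subset> S" by (auto simp: triangular_partition_def)
    moreover have "finite S" using less.prems finite_subset by blast
    ultimately have "card X < card S" "card Y < card S" "X \<subseteq> {..<n}" "Y \<subseteq> {..<n}"
      using less.prems by (auto intro: psubset_card_mono)
    then obtain Xs Ys where "triangular_partition A X Xs" "triangular_partition A Y Ys"
      "\<forall>X\<in>set Xs \<union> set Ys. irreducible_mat (principal_submatrix A X)"
      using less.hyps[of X] less.hyps[of Y] by fast
    then show ?thesis
      using triangular_partition_append[OF XY] by (metis set_append)
  qed
qed


section \<open>The determinant of a block triangular matrix\<close>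

lemma det_permute_both:
  assumes N: "N \<in> carrier_mat c c" and \<sigma>: "\<sigma> permutes {..<c}"
  shows "det (mat c c (\<lambda>(i, j). N $$ (\<sigma> i, \<sigma> j))) = det N"
proof -
  have \<sigma>': "\<sigma> permutes {0..<c}" using \<sigma> by (simp add: lessThan_atLeast0)
  have less: "\<sigma> i < c" if "i < c" for i using permutes_in_image[OF \<sigma>, of i] that by simp
  define R where "R = mat c c (\<lambda>(i, j). N $$ (\<sigma> i, j))"
  have R: "R \<in> carrier_mat c c" by (simp add: R_def)
  have "mat c c (\<lambda>(i, j). N $$ (\<sigma> i, \<sigma> j)) = (mat c c (\<lambda>(i, j). R\<^sup>T $$ (\<sigma> i, j)))\<^sup>T"
    by (rule eq_matI) (auto simp: R_def less)
  then have "det (mat c c (\<lambda>(i, j). N $$ (\<sigma> i, \<sigma> j))) = det (mat c c (\<lambda>(i, j). R\<^sup>T $$ (\<sigma> i, j)))"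
    using det_transpose[of "mat c c (\<lambda>(i, j). R\<^sup>T $$ (\<sigma> i, j))" c] by simp
  also have "\<dots> = signof \<sigma> * (signof \<sigma> * det N)"
    using R det_permute_rows[of "R\<^sup>T" c, OF _ \<sigma>'] det_permute_rows[OF N \<sigma>'] det_transpose[OF R]
    by (simp add: R_def)
  also have "\<dots> = det N"
    by (simp add: sign_def)
  finally show ?thesis .
qed

lemma det_reindex:
  fixes X :: "nat \<Rightarrow> nat \<Rightarrow> 'a::comm_ring_1"
  assumes v: "bij_betw v {..<c} S" and w: "bij_betw w {..<c} S"
  shows "det (mat c c (\<lambda>(i, j). X (v i) (v j))) = det (mat c c (\<lambda>(i, j). X (w i) (w j)))"
proof -
  define \<sigma> where "\<sigma> i = (if i < c then inv_into {..<c} w (v i) else i)" for i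
  have "bij_betw (inv_into {..<c} w \<circ> v) {..<c} {..<c}"
    by (rule bij_betw_trans[OF v bij_betw_inv_into[OF w]])
  then have "bij_betw \<sigma> {..<c} {..<c}"
    by (rule bij_betw_cong[THEN iffD1, rotated]) (simp add: \<sigma>_def)
  then have \<sigma>: "\<sigma> permutes {..<c}"
    by (intro bij_imp_permutes) (auto simp: \<sigma>_def)
  have less: "\<sigma> i < c" if "i < c" for i using permutes_in_image[OF \<sigma>, of i] that by simp
  have w\<sigma>: "w (\<sigma> i) = v i" if "i < c" for i
    using that v w by (auto simp: \<sigma>_def bij_betw_def intro!: f_inv_into_f)
  have "mat c c (\<lambda>(i, j). X (v i) (v j))
      = mat c c (\<lambda>(i, j). mat c c (\<lambda>(i, j). X (w i) (w j)) $$ (\<sigma> i, \<sigma> j))"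
    by (rule eq_matI) (auto simp: less w\<sigma>)
  then show ?thesis
    using det_permute_both[OF _ \<sigma>, of "mat c c (\<lambda>(i, j). X (w i) (w j))"] by simp
qed

subsection \<open>Principal minors of the matrix with variables\<close>

definition principal_var_minor :: "'a::comm_ring_1 mat \<Rightarrow> nat set \<Rightarrow> 'a mpolynomial" where
  "principal_var_minor A S = det_diag_plus S (principal_submatrix A S)"

lemma principal_var_minor_var_mat:
  assumes "A \<in> carrier_mat n n" "S \<subseteq> {..<n}"
  shows "principal_var_minor A S = det (var_mat (pick S) (principal_submatrix A S))"
  using principal_submatrix_carrier[OF assms]
  by (simp add: principal_var_minor_def det_diag_plus_def var_mat_def)

text \<open>The order in which the rows and columns are listed does not matter. This allows listing a union block by block.\<close>

lemma principal_var_minor_enum: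
  assumes A: "A \<in> carrier_mat n n" and S: "S \<subseteq> {..<n}" and v: "bij_betw v {..<c} S"
  shows "principal_var_minor A S = det (mat c c (\<lambda>(i, j).
    (if v i = v j then mvar (v j) else 0) + mconst (A $$ (v i, v j))))"
proof -
  have fin: "finite S" using S finite_subset by blast
  have c: "c = card S" using bij_betw_same_card[OF v] by simp
  have p: "bij_betw (pick S) {..<c} S" using bij_betw_pick[OF fin] by (simp add: c)
  have "var_mat (pick S) (principal_submatrix A S) = mat c c (\<lambda>(i, j).
      (if pick S i = pick S j then mvar (pick S j) else 0) + mconst (A $$ (pick S i, pick S j)))"
    using p by (intro eq_matI)
      (auto simp: principal_submatrix_eq[OF A S] c var_mat_def mat_diag_def bij_betw_def inj_on_eq_iff)
  then show ?thesis
    unfolding principal_var_minor_var_mat[OF A S]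
    using det_reindex[OF p v, of "\<lambda>k l. (if k = l then mvar l else 0) + mconst (A $$ (k, l))"]
    by simp
qed

lemma principal_var_minor_two_blocks:
  fixes A :: "'a::idom mat"
  assumes A: "A \<in> carrier_mat n n" and X: "X \<subseteq> {..<n}" and Y: "Y \<subseteq> {..<n}"
    and disj: "X \<inter> Y = {}" and zero: "\<And>i j. i \<in> Y \<Longrightarrow> j \<in> X \<Longrightarrow> A $$ (i, j) = 0"
  shows "principal_var_minor A (X \<union> Y) = principal_var_minor A X * principal_var_minor A Y"
proof -
  have fin: "finite X" "finite Y" using X Y finite_subset by blast+
  let ?a = "card X" and ?b = "card Y"
  define E where "E k l = (if k = l then mvar l else 0) + mconst (A $$ (k, l))" for k l
  define v where "v i = (if i < ?a then pick X i else pick Y (i - ?a))" for i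
  have px: "pick X i \<in> X" if "i < ?a" for i using that pick_in_set_le by blast
  have py: "pick Y i \<in> Y" if "i < ?b" for i using that pick_in_set_le by blast
  have vb: "bij_betw v {..<?a + ?b} (X \<union> Y)"
  proof -
    have "bij_betw v {..<?a} X"
      using bij_betw_pick[OF fin(1)] by (rule bij_betw_cong[THEN iffD1, rotated]) (simp add: v_def)
    moreover have "bij_betw v {?a..<?a + ?b} Y"
    proof -
      have "bij_betw (\<lambda>i. i - ?a) {?a..<?a + ?b} {..<?b}"
        by (rule bij_betw_byWitness[where f' = "\<lambda>i. i + ?a"]) auto
      then have "bij_betw (pick Y \<circ> (\<lambda>i. i - ?a)) {?a..<?a + ?b} Y"
        using bij_betw_pick[OF fin(2)] by (rule bij_betw_trans)
      then show ?thesis by (rule bij_betw_cong[THEN iffD1, rotated]) (simp add: v_def)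
    qed
    ultimately have "bij_betw v ({..<?a} \<union> {?a..<?a + ?b}) (X \<union> Y)"
      using disj by (rule bij_betw_combine)
    then show ?thesis by (simp add: ivl_disj_un)
  qed
  let ?A1 = "mat ?a ?a (\<lambda>(i, j). E (pick X i) (pick X j))"
  let ?A2 = "mat ?a ?b (\<lambda>(i, j). E (pick X i) (pick Y j))"
  let ?A4 = "mat ?b ?b (\<lambda>(i, j). E (pick Y i) (pick Y j))"
  have low: "E (pick Y i) (pick X j) = 0" if "i < ?b" "j < ?a" for i j
    using px[OF that(2)] py[OF that(1)] disj zero by (auto simp: E_def mconst_def)
  have "mat (?a + ?b) (?a + ?b) (\<lambda>(i, j). E (v i) (v j)) = four_block_mat ?A1 ?A2 (0\<^sub>m ?b ?a) ?A4"
    by (rule eq_matI) (auto simp: v_def low)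
  then have "det (mat (?a + ?b) (?a + ?b) (\<lambda>(i, j). E (v i) (v j))) = det ?A1 * det ?A4"
    by (simp add: det_four_block_mat_lower_left_zero[of _ ?a _ ?b])
  then show ?thesis
    using X Y by (simp add: principal_var_minor_enum[OF A _ vb] principal_var_minor_enum[OF A X bij_betw_pick[OF fin(1)]]
        principal_var_minor_enum[OF A Y bij_betw_pick[OF fin(2)]] E_def)
qed

lemma principal_var_minor_triangular_partition:
  fixes A :: "'a::idom mat"
  assumes A: "A \<in> carrier_mat n n"
  shows "triangular_partition A S Ss \<Longrightarrow> S \<subseteq> {..<n} \<Longrightarrow>
    principal_var_minor A S = (\<Prod>X\<in>set Ss. principal_var_minor A X)"
proof (induction Ss arbitrary: S)
  case Nil
  then have "S = {}" by (simp add: triangular_partition_def)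
  then show ?case
    by (simp add: principal_var_minor_def det_diag_plus_def principal_submatrix_def submatrix_def det_dim_zero)
next
  case (Cons X Ss)
  let ?Y = "\<Union>(set Ss)"
  have S: "S = X \<union> ?Y" and disj: "X \<inter> ?Y = {}" and part: "triangular_partition A ?Y Ss"
    and zero: "\<And>i j. i \<in> ?Y \<Longrightarrow> j \<in> X \<Longrightarrow> A $$ (i, j) = 0"
    using Cons.prems(1) by (auto simp: triangular_partition_def)
  have sub: "X \<subseteq> {..<n}" "?Y \<subseteq> {..<n}" using Cons.prems(2) S by auto
  have notin: "X \<notin> set Ss"
    using triangular_partition_distinct[OF Cons.prems(1)] by simp
  have "principal_var_minor A S = principal_var_minor A X * principal_var_minor A ?Y"
    unfolding S by (rule principal_var_minor_two_blocks[OF A sub disj zero])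
  then show ?case
    using Cons.IH[OF part sub(2)] notin by simp
qed

lemma principal_var_minor_in_polys_in:
  assumes A: "A \<in> carrier_mat n n" and S: "S \<subseteq> {..<n}"
  shows "principal_var_minor A S \<in> polys_in S"
proof -
  have "finite S" using S finite_subset by blast
  then have "pick S ` {..<card S} = S" using bij_betw_pick by (auto simp: bij_betw_def)
  then show ?thesis
    using det_var_mat_in_polys_in[OF principal_submatrix_carrier[OF A S], of "pick S"]
    by (simp add: principal_var_minor_var_mat[OF A S])
qed

lemma mcoeff_principal_var_minor_top:
  assumes A: "A \<in> carrier_mat n n" and S: "S \<subseteq> {..<n}"
  shows "mcoeff (principal_var_minor A S) (squarefree_monomial S) = 1"
proof -
  have "finite S" using S finite_subset by blast
  then have "pick S ` {..<card S} = S" "inj_on (pick S) {..<card S}"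
    using bij_betw_pick by (auto simp: bij_betw_def)
  then show ?thesis
    using mcoeff_det_var_mat_top[OF principal_submatrix_carrier[OF A S], of "pick S"]
    by (simp add: principal_var_minor_var_mat[OF A S])
qed

lemma irreducible_principal_var_minor:
  fixes A :: "'a::field mat"
  assumes A: "A \<in> carrier_mat n n" and S: "S \<subseteq> {..<n}" "S \<noteq> {}"
    and irr: "irreducible_mat (principal_submatrix A S)"
  shows "irreducible (principal_var_minor A S)"
proof -
  have fin: "finite S" using S(1) finite_subset by blast
  note B = principal_submatrix_carrier[OF A S(1)]
  show ?thesis
    unfolding principal_var_minor_var_mat[OF A S(1)]
    by (rule irreducible_det_var_mat[OF B])
      (use fin S(2) bij_betw_pick[OF fin] irreducible_mat_strongly_connected[OF B irr]
       in \<open>auto simp: bij_betw_def card_gt_0_iff\<close>)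
qed

lemma reachable_in_principal_submatrix:
  assumes A: "A \<in> carrier_mat n n" and S: "S \<subseteq> {..<n}"
    and path: "(a, b) \<in> (digraph_edges (principal_submatrix A S))\<^sup>*"
  shows "(pick S a, pick S b) \<in> (digraph_edges A)\<^sup>*"
  using path
proof (induction rule: rtrancl_induct)
  case (step b c)
  then have bc: "b < card S" "c < card S" "A $$ (pick S b, pick S c) \<noteq> 0"
    by (auto simp: digraph_edges_def principal_submatrix_eq[OF A S])
  then have "pick S b \<in> S" "pick S c \<in> S" using pick_in_set_le by blast+
  then have "(pick S b, pick S c) \<in> digraph_edges A"
    using bc A S by (auto simp: digraph_edges_def)
  with step.IH show ?case by (rule rtrancl.rtrancl_into_rtrancl)
qed simp

lemma irreducible_block_strongly_connected:
  assumes A: "A \<in> carrier_mat n n" and S: "S \<subseteq> {..<n}"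
    and irr: "irreducible_mat (principal_submatrix A S)" and ij: "i \<in> S" "j \<in> S"
  shows "(i, j) \<in> (digraph_edges A)\<^sup>*"
proof -
  have "finite S" using S finite_subset by blast
  then have "pick S ` {..<card S} = S" using bij_betw_pick by (auto simp: bij_betw_def)
  then obtain a b where "a < card S" "b < card S" "i = pick S a" "j = pick S b"
    using ij by (metis imageE lessThan_iff)
  then show ?thesis
    using irreducible_mat_strongly_connected[OF principal_submatrix_carrier[OF A S] irr]
      reachable_in_principal_submatrix[OF A S] by simp
qed


section \<open>Factors in disjoint sets of variables\<close>

text \<open>The coefficients of \<open>p i\<close> are those of the product at monomials that contain each variable of the other sets
  exactly once, as the other factors contribute their coefficient \<open>1\<close> there.\<close>

lemma factors_unique:
  fixes p q :: "nat \<Rightarrow> 'a::comm_ring_1 mpolynomial"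
  assumes I: "finite I" and disj: "disjoint_family_on V I" and fin: "\<And>i. i \<in> I \<Longrightarrow> finite (V i)"
    and p: "\<And>i. i \<in> I \<Longrightarrow> p i \<in> polys_in (V i)" "\<And>i. i \<in> I \<Longrightarrow> mcoeff (p i) (squarefree_monomial (V i)) = 1"
    and q: "\<And>i. i \<in> I \<Longrightarrow> q i \<in> polys_in (V i)" "\<And>i. i \<in> I \<Longrightarrow> mcoeff (q i) (squarefree_monomial (V i)) = 1"
    and eq: "(\<Prod>i\<in>I. p i) = (\<Prod>i\<in>I. q i)" and i: "i \<in> I"
  shows "p i = q i"
proof (rule mpolynomial_eqI)
  fix m
  show "mcoeff (p i) m = mcoeff (q i) m"
  proof (cases "Poly_Mapping.keys m \<subseteq> V i")
    case False
    then have "mcoeff (p i) m = 0" "mcoeff (q i) m = 0"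
      using p(1)[OF i] q(1)[OF i] unfolding in_polys_in_iff by blast+
    then show ?thesis by simp
  next
    case True
    \<comment> \<open>One monomial for each factor; together they isolate the coefficient of \<open>m\<close> in the \<open>i\<close>-th factor.\<close>
    define a where "a j = (if j = i then m else squarefree_monomial (V j))" for j
    have a: "Poly_Mapping.keys (a j) \<subseteq> V j" if "j \<in> I" for j
      using that True fin by (auto simp: a_def keys_squarefree_monomial)
    have only_i: "(\<Prod>j\<in>I. mcoeff (r j) (a j)) = mcoeff (r i) m"
      if "\<And>j. j \<in> I \<Longrightarrow> mcoeff (r j) (squarefree_monomial (V j)) = 1" for r :: "nat \<Rightarrow> 'a mpolynomial"
      using that I i by (simp add: prod.remove[of I i] a_def)
    have "mcoeff (p i) m = mcoeff (\<Prod>j\<in>I. p j) (\<Sum>j\<in>I. a j)"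
      using mcoeff_prod_disjoint[OF I p(1) disj a] only_i[OF p(2)] by simp
    also have "\<dots> = mcoeff (q i) m"
      unfolding eq using mcoeff_prod_disjoint[OF I q(1) disj a] only_i[OF q(2)] by simp
    finally show ?thesis .
  qed
qed

lemma irreducible_prod_imp_singleton:
  fixes q :: "'b \<Rightarrow> 'a::idom"
  assumes fin: "finite G" and q: "\<And>X. X \<in> G \<Longrightarrow> irreducible (q X)" and irr: "irreducible (\<Prod>X\<in>G. q X)"
  obtains X where "G = {X}"
proof -
  have "G \<noteq> {}" using irr by auto
  then obtain X where X: "X \<in> G" by blast
  have "(\<Prod>X\<in>G. q X) = q X * (\<Prod>X\<in>G - {X}. q X)" by (rule prod.remove[OF fin X])
  then have "q X dvd 1 \<or> (\<Prod>X\<in>G - {X}. q X) dvd 1" using irr by (rule irreducibleD[rotated])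
  then have unit: "(\<Prod>X\<in>G - {X}. q X) dvd 1" using q[OF X] by (simp add: irreducible_not_unit)
  have "G - {X} = {}"
  proof (rule ccontr)
    assume "G - {X} \<noteq> {}"
    then obtain Y where Y: "Y \<in> G - {X}" by blast
    then have "q Y dvd (\<Prod>X\<in>G - {X}. q X)" using fin by (intro dvd_prodI) auto
    then have "q Y dvd 1" using unit by (rule dvd_trans)
    then show False using q Y by (simp add: irreducible_not_unit)
  qed
  then have "G = {X}" using X by blast
  then show ?thesis by (rule that)
qed


section \<open>Irreducible factors and irreducible blocks\<close>

text \<open>The heart of the direction from factors to blocks. Each irreducible block \<open>X\<close> of a triangular form lies in one
  \<open>T i\<close>, because its indices are joined by paths both ways, and a factorization cannot separate such indices. Grouping the
  minors of the blocks by the \<open>T i\<close> reproduces the factors \<open>fs i\<close>, whose irreducibility leaves one block per group.\<close>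

lemma irreducible_factors_are_blocks:
  fixes A :: "'a::field mat" and T :: "nat \<Rightarrow> nat set" and fs :: "nat \<Rightarrow> 'a mpolynomial"
  assumes A: "A \<in> carrier_mat n n"
    and T_partition: "(\<Union>i<s. T i) = {..<n}" "disjoint_family_on T {..<s}"
    and T_nonempty: "\<And>i. i < s \<Longrightarrow> T i \<noteq> {}"
    and fs_vars: "\<And>i. i < s \<Longrightarrow> fs i \<in> polys_in (T i)"
    and fs_coeff: "\<And>i. i < s \<Longrightarrow> mcoeff (fs i) (squarefree_monomial (T i)) = 1"
    and prod: "principal_var_minor A {..<n} = (\<Prod>i<s. fs i)"
    and irr: "\<And>i. i < s \<Longrightarrow> irreducible (fs i)"
    and part: "triangular_partition A {..<n} Ss"
    and blocks: "\<And>X. X \<in> set Ss \<Longrightarrow> irreducible_mat (principal_submatrix A X)"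
  shows "set Ss = T ` {..<s}" "\<And>i. i < s \<Longrightarrow> fs i = principal_var_minor A (T i)"
proof -
  have T_sub: "T i \<subseteq> {..<n}" if "i < s" for i using T_partition(1) that by blast
  have T_fin: "finite (T i)" if "i < s" for i using T_sub[OF that] finite_subset by blast
  have T_disj: "T i \<inter> T j = {}" if "i < s" "j < s" "i \<noteq> j" for i j
    using T_partition(2) that by (auto simp: disjoint_family_on_def)
  have Ss_sub: "X \<subseteq> {..<n}" "X \<noteq> {}" if "X \<in> set Ss" for X
    using part that by (auto simp: triangular_partition_def)
  have Ss_fin: "finite X" if "X \<in> set Ss" for X using Ss_sub(1)[OF that] finite_subset by blast
  have whole: "principal_var_minor A {..<n} = det (var_mat (\<lambda>i. i) A)"
    using principal_var_minor_enum[OF A order_refl, of "\<lambda>i. i" n] A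
    by (simp add: bij_betw_def var_mat_def mat_diag_def) (rule arg_cong[of _ _ det], auto intro!: eq_matI)
  have inside: "\<exists>i<s. X \<subseteq> T i" if X: "X \<in> set Ss" for X
  proof -
    obtain a where a: "a \<in> X" using Ss_sub(2)[OF X] by blast
    then have "a \<in> {..<n}" using Ss_sub(1)[OF X] by blast
    then obtain i where i: "i < s" "a \<in> T i" using T_partition(1) by blast
    have "b \<in> T i" if b: "b \<in> X" for b
    proof (rule ccontr)
      assume not: "b \<notin> T i"
      have ab: "a < n" "b < n" "a \<noteq> b" using a b i not Ss_sub(1)[OF X] by auto
      have "det (var_mat (\<lambda>i. i) A) = fs i * (\<Prod>j\<in>{..<s} - {i}. fs j)"
        using i by (simp add: whole[symmetric] prod prod.remove)
      moreover have "fs i \<in> polys_in (-{b})"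
        by (rule polys_in_mono[OF fs_vars[OF i(1)]]) (use not in auto)
      moreover have "(\<Prod>j\<in>{..<s} - {i}. fs j) \<in> polys_in (-{a})"
        using i(2) T_disj[OF i(1)] by (intro prod_in_polys_in polys_in_mono[OF fs_vars]) auto
      ultimately show False
        using factors_separate_no_cycle[OF A _ ab(1,2,3)]
          irreducible_block_strongly_connected[OF A Ss_sub(1)[OF X] blocks[OF X]] a b
        by (metis inj_on_id2)
    qed
    then show ?thesis using i(1) by blast
  qed
  \<comment> \<open>\<open>G i\<close>: the blocks inside \<open>T i\<close>; \<open>F i\<close>: the product of their minors.\<close>
  define G where "G i = {X \<in> set Ss. X \<subseteq> T i}" for i
  define F where "F i = (\<Prod>X\<in>G i. principal_var_minor A X)" for i
  have G_UN: "(\<Union>i<s. G i) = set Ss" using inside by (auto simp: G_def)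
  have G_disj: "G i \<inter> G j = {}" if "i < s" "j < s" "i \<noteq> j" for i j
    using T_disj[OF that] Ss_sub(2) by (fastforce simp: G_def)
  have T_UN: "T i = (\<Union>X\<in>G i. X)" if i: "i < s" for i
  proof
    show "T i \<subseteq> (\<Union>X\<in>G i. X)"
    proof
      fix a assume a: "a \<in> T i"
      then obtain X where X: "X \<in> set Ss" "a \<in> X"
        using T_sub[OF i] part unfolding triangular_partition_def by blast
      obtain j where j: "j < s" "X \<subseteq> T j" using inside[OF X(1)] by blast
      then have "j = i" using T_disj[OF j(1) i] a X(2) by blast
      then show "a \<in> (\<Union>X\<in>G i. X)" using X j by (auto simp: G_def)
    qed
  qed (auto simp: G_def)
  have "(\<Prod>i<s. fs i) = (\<Prod>X\<in>set Ss. principal_var_minor A X)"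
    using principal_var_minor_triangular_partition[OF A part] prod by simp
  also have "\<dots> = (\<Prod>i<s. F i)"
    unfolding G_UN[symmetric] F_def using G_disj
    by (intro prod.UNION_disjoint) (auto simp: G_def)
  finally have prod_eq: "(\<Prod>i<s. fs i) = (\<Prod>i<s. F i)" .
  have disj_G: "disjoint_family_on (\<lambda>X. X) (G i)" for i
    using triangular_partition_disjoint[OF part] by (auto simp: disjoint_family_on_def G_def)
  have F_vars: "F i \<in> polys_in (T i)" if "i < s" for i
    unfolding F_def using Ss_sub
    by (intro prod_in_polys_in polys_in_mono[OF principal_var_minor_in_polys_in[OF A]]) (auto simp: G_def)
  have F_coeff: "mcoeff (F i) (squarefree_monomial (T i)) = 1" if i: "i < s" for i
  proof -
    have finG: "finite (G i)" by (simp add: G_def)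
    have "squarefree_monomial (T i) = (\<Sum>X\<in>G i. squarefree_monomial X)"
      by (subst T_UN[OF i], rule squarefree_monomial_UN[OF finG _ disj_G]) (auto simp: G_def Ss_fin)
    also have "mcoeff (F i) \<dots> = (\<Prod>X\<in>G i. mcoeff (principal_var_minor A X) (squarefree_monomial X))"
      unfolding F_def using Ss_sub Ss_fin
      by (intro mcoeff_prod_disjoint[OF finG _ disj_G] principal_var_minor_in_polys_in[OF A])
        (auto simp: G_def keys_squarefree_monomial)
    also have "\<dots> = 1"
      using Ss_sub by (intro prod.neutral ballI mcoeff_principal_var_minor_top[OF A]) (auto simp: G_def)
    finally show ?thesis .
  qed
  have fs_F: "fs i = F i" if "i < s" for i
    using that
    by (intro factors_unique[OF _ T_partition(2) _ fs_vars fs_coeff F_vars F_coeff prod_eq]) (auto intro: T_fin)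
  have G_single: "G i = {T i}" if i: "i < s" for i
  proof -
    have "irreducible (principal_var_minor A X)" if "X \<in> G i" for X
      using that Ss_sub blocks by (intro irreducible_principal_var_minor[OF A]) (auto simp: G_def)
    moreover have "irreducible (\<Prod>X\<in>G i. principal_var_minor A X)"
      using irr[OF i] fs_F[OF i] by (simp add: F_def)
    ultimately obtain X where "G i = {X}"
      using irreducible_prod_imp_singleton[of "G i" "principal_var_minor A"] by (auto simp: G_def)
    then show ?thesis using T_UN[OF i] by simp
  qed
  show "set Ss = T ` {..<s}"
    unfolding G_UN[symmetric] using G_single by auto
  show "fs i = principal_var_minor A (T i)" if "i < s" for i
    using fs_F[OF that] G_single[OF that] by (simp add: F_def)
qed

theorem theorem5p2:
  fixes A :: "'a::field mat" and n s :: nat and T :: "nat \<Rightarrow> nat set"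
    and f :: "'a mpolynomial" and fs :: "nat \<Rightarrow> 'a mpolynomial"
  assumes A: "A \<in> carrier_mat n n"
    and f: "f = det (mat_diag n mvar + map_mat mconst A)"
    and T_partition: "(\<Union>i<s. T i) = {..<n}" "disjoint_family_on T {..<s}"
    and T_nonempty: "\<And>i. i < s \<Longrightarrow> T i \<noteq> {}"
    and fs_vars: "\<And>i. i < s \<Longrightarrow> fs i \<in> polys_in (T i)"
    and fs_coeff: "\<And>i. i < s \<Longrightarrow> mcoeff (fs i) (squarefree_monomial (T i)) = 1"
  shows "(f = (\<Prod>i<s. fs i) \<and> (\<forall>i<s. irreducible (fs i))) \<longleftrightarrow>
    (\<exists>\<sigma> \<pi> ds. \<sigma> permutes {..<n} \<and> \<pi> permutes {..<s} \<and> length ds = s \<and>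
        block_upper_triangular ds (permute_mat \<sigma> A) \<and>
        (\<forall>k<s. \<sigma> ` block_indices ds k = T (\<pi> k) \<and>
           principal_submatrix (permute_mat \<sigma> A) (block_indices ds k)
             = principal_submatrix A (T (\<pi> k)))) \<and>
    (\<forall>i<s. irreducible_mat (principal_submatrix A (T i)) \<and>
        fs i = det_diag_plus (T i) (principal_submatrix A (T i)))"
    (is "?factors \<longleftrightarrow> ?blocks \<and> ?minors")
proof -
  have f_minor: "f = principal_var_minor A {..<n}"
    unfolding f principal_var_minor_def principal_submatrix_all[OF A] det_diag_plus_def
    by (rule arg_cong[of _ _ det], rule eq_matI) (use A in \<open>auto simp: mat_diag_def pick_lessThan\<close>)
  have T_sub: "T i \<subseteq> {..<n}" if "i < s" for i using T_partition(1) that by blast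
  have T_inj: "inj_on T {..<s}"
    using T_partition(2) T_nonempty by (fastforce simp: inj_on_def disjoint_family_on_def)
  show ?thesis
  proof
    assume factors: ?factors
    then have prod_fs: "principal_var_minor A {..<n} = (\<Prod>i<s. fs i)"
      and irr_fs: "\<And>i. i < s \<Longrightarrow> irreducible (fs i)"
      by (simp_all add: f_minor)
    obtain Ss where Ss: "triangular_partition A {..<n} Ss"
      and irr: "\<And>X. X \<in> set Ss \<Longrightarrow> irreducible_mat (principal_submatrix A X)"
      using triangular_partition_irreducible_blocks[OF A order_refl] by blast
    have set: "set Ss = T ` {..<s}" and fs: "\<And>i. i < s \<Longrightarrow> fs i = principal_var_minor A (T i)"
      using irreducible_factors_are_blocks[OF A T_partition T_nonempty fs_vars fs_coeff prod_fs irr_fs Ss irr]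
      by blast+
    have dist: "distinct Ss" by (rule triangular_partition_distinct[OF Ss])
    have len: "length Ss = s"
      using distinct_card[OF dist] by (simp add: set card_image[OF T_inj])
    define \<pi> where "\<pi> k = (if k < s then inv_into {..<s} T (Ss ! k) else k)" for k
    have "bij_betw ((!) Ss) {..<s} (T ` {..<s})"
      by (rule bij_betw_nth[OF dist]) (simp_all only: set len)
    moreover have "bij_betw (inv_into {..<s} T) (T ` {..<s}) {..<s}"
      using T_inj by (intro bij_betw_inv_into) (simp add: bij_betw_def)
    ultimately have "bij_betw (inv_into {..<s} T \<circ> (!) Ss) {..<s} {..<s}" by (rule bij_betw_trans)
    then have "bij_betw \<pi> {..<s} {..<s}"
      by (rule bij_betw_cong[THEN iffD1, rotated]) (simp add: \<pi>_def)
    then have \<pi>: "\<pi> permutes {..<s}"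
      by (intro bij_imp_permutes) (auto simp: \<pi>_def)
    have T\<pi>: "T (\<pi> k) = Ss ! k" if "k < s" for k
    proof -
      have "Ss ! k \<in> T ` {..<s}" using that len set nth_mem by blast
      then show ?thesis using that by (simp add: \<pi>_def f_inv_into_f)
    qed
    obtain \<sigma> where "\<sigma> permutes {..<n}" "block_upper_triangular (map card Ss) (permute_mat \<sigma> A)"
      "\<And>k. k < length Ss \<Longrightarrow> \<sigma> ` block_indices (map card Ss) k = Ss ! k"
      "\<And>k. k < length Ss \<Longrightarrow> principal_submatrix (permute_mat \<sigma> A) (block_indices (map card Ss) k)
         = principal_submatrix A (Ss ! k)"
      by (rule triangular_partition_permutation[OF A Ss]) blast
    then have ?blocks
      using \<pi> len T\<pi> by (intro exI[of _ \<sigma>] exI[of _ \<pi>] exI[of _ "map card Ss"]) simp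
    moreover have ?minors
      using fs irr set by (auto simp: principal_var_minor_def)
    ultimately show "?blocks \<and> ?minors" by blast
  next
    assume "?blocks \<and> ?minors"
    then obtain \<sigma> \<pi> ds where \<sigma>: "\<sigma> permutes {..<n}" and \<pi>: "\<pi> permutes {..<s}" and len: "length ds = s"
      and tri: "block_upper_triangular ds (permute_mat \<sigma> A)"
      and T\<pi>: "\<And>k. k < s \<Longrightarrow> \<sigma> ` block_indices ds k = T (\<pi> k)" and minors: ?minors
      by blast
    let ?Ss = "map (\<lambda>k. \<sigma> ` block_indices ds k) [0..<length ds]"
    have part: "triangular_partition A {..<n} ?Ss"
      by (rule block_upper_triangular_partition[OF A \<sigma> tri])
    have "set ?Ss = (\<lambda>k. T (\<pi> k)) ` {..<s}"
      by (auto simp: len T\<pi> image_iff)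
    also have "\<dots> = T ` {..<s}"
      using permutes_image[OF \<pi>] by (metis image_image)
    finally have "f = (\<Prod>X\<in>T ` {..<s}. principal_var_minor A X)"
      using principal_var_minor_triangular_partition[OF A part order_refl] by (simp add: f_minor)
    also have "\<dots> = (\<Prod>i<s. principal_var_minor A (T i))"
      by (simp add: prod.reindex[OF T_inj])
    also have "\<dots> = (\<Prod>i<s. fs i)"
      using minors by (intro prod.cong) (simp_all add: principal_var_minor_def)
    finally show ?factors
      using minors irreducible_principal_var_minor[OF A T_sub T_nonempty]
      by (auto simp: principal_var_minor_def)
  qed
qed

end
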